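(* Let $H$ be the $7$-dimensional Heisenberg group, with left-invariant coframe $e^1,\dots,e^7$ satisfying $de^i=0$ for $i=1,\dots,6$ and $de^7=e^{12}+e^{34}+e^{56}$. Let $$\varphi_0=e^{127}+e^{347}+e^{567}+e^{135}-e^{146}-e^{236}-e^{245},$$ and, for smooth functions $f_t,a_t,b_t,c_t$ of $t$ with $f(0)=a(0)=b(0)=c(0)=1$, consider the family of left-invariant $\mathrm{G}_2$-structures $$\varphi_t=f_t\left(a_t^2e^{127}+b_t^2e^{347}+c_t^2e^{567}\right)+a_tb_tc_t\left(e^{135}-e^{146}-e^{236}-e^{245}\right).$$ Then $\varphi_t$ is a solution to the Ricci-harmonic flow with initial $\mathrm{G}_2$-structure $\varphi_0$ if and only if $f_t,a_t,b_t,c_t$ satisfy the system of ODEs $$\frac{d(f_ta_t^2)}{dt}=-\frac{f_t^3\left(4a_t^4(b_t^4+c_t^4)-b_t^4c_t^4\right)}{2a_t^2b_t^4c_t^4},$$ $$\frac{d(f_tb_t^2)}{dt}=-\frac{f_t^3\left(4b_t^4(a_t^4+c_t^4)-a_t^4c_t^4\right)}{2a_t^4b_t^2c_t^4},$$ $$\frac{d(f_tc_t^2)}{dt}=-\frac{f_t^3\left(4c_t^4(a_t^4+b_t^4)-a_t^4b_t^4\right)}{2a_t^4b_t^4c_t^2},$$ $$\frac{d(a_tb_tc_t)}{dt}=-\frac{f_t^2\left(3(a_tb_tc_t)^2(a_t^2+b_t^2+c_t^2)+2(a_t^4b_t^4+a_t^4c_t^4+b_t^4c_t^4)\right)}{2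a_t^3b_t^3c_t^3}.$$
   Context: **Notation.** $e^{ij\cdots}=e^i\wedge e^j\wedge\cdots$. The $7$-dimensional Heisenberg group $H$ is the simply connected nilpotent Lie group whose Lie algebra has a basis $e_1,\dots,e_7$ with nonzero brackets $[e_1,e_2]=[e_3,e_4]=[e_5,e_6]=-e_7$; $e^i$ is the dual coframe. The functions $f_t,a_t,b_t,c_t$ are defined on an interval containing $0$ and are positive there, so that $\varphi_t$ is a $\mathrm{G}_2$-structure; its metric is $g_t=a_t^2((e^1)^2+(e^2)^2)+b_t^2((e^3)^2+(e^4)^2)+c_t^2((e^5)^2+(e^6)^2)+f_t^2(e^7)^2$ and its volume form is $f_ta_t^2b_t^2c_t^2\,e^1\wedge\dots\wedge e^7$. **$\mathrm{G}_2$-structures.** A $\mathrm{G}_2$-structure on an oriented $7$-manifold is a nondegenerate $3$-form $\varphi$, i.e. one determining a Riemannian metric $g_\varphi$ and volume form by $(X\lrcorner\varphi)\wedge(Y\lrcorner\varphi)\wedge\varphi=6\,g_\varphi(X,Y)\,\mathrm{vol}_\varphi$. Put $\psi=*_\varphi\varphi$. The torsion is the $2$-tensor $T$ defined by $\nabla_m\varphi_{ijk}=T_m{}^{p}\psi_{pijk}$, with $\nabla$ the Levi-Civita connection of $g_\varphi$; $(T^tT)_{ij}=T^k{}_iT_{kj}$, $|T|^2=T_{ij}T^{ij}$, $(\mathrm{div}\,T)_i=\nabla^jT_{ji}$. For a $2$-tensor $A$ and a $k$-form $\gamma$, $(A\diamond\gamma)_{i_1\cdots i_k}=A_{i_1}{}^{p}\gamma_{pi_2\cdots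 i_k}+\cdots+A_{i_k}{}^{p}\gamma_{i_1\cdots i_{k-1}p}$. **Ricci-harmonic flow.** $$\frac{\partial\varphi}{\partial t}=\left(-\mathrm{Ric}+3T^tT-|T|^2g\right)\diamond\varphi+\mathrm{div}\,T\lrcorner\psi,\qquad \varphi(0)=\varphi_0.$$ *)

theory Defs
  imports "HOL-Analysis.Analysis"
begin

section \<open>The Heisenberg group and its left-invariant frame\<close>

text \<open>
  The Heisenberg group is \<open>\<real>\<^sup>7\<close> with the multiplication given by the (two-step)
  Baker--Campbell--Hausdorff formula. The index type is \<^typ>\<open>7\<close>, whose elements are written
  \<open>1, \<dots>, 7\<close>; arithmetic on it is modulo 7, so the index \<open>7\<close> is the same element as \<open>0\<close>.
\<close>

type_synonym heis = "real^7"

definition heis_bracket :: "real^7 \<Rightarrow> real^7 \<Rightarrow> real^7" where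
  "heis_bracket x y =
     - ((x$1 * y$2 - x$2 * y$1) + (x$3 * y$4 - x$4 * y$3) + (x$5 * y$6 - x$6 * y$5)) *\<^sub>R axis 7 1"

definition heis_mult :: "heis \<Rightarrow> heis \<Rightarrow> heis" where
  "heis_mult x y = x + y + (1/2) *\<^sub>R heis_bracket x y"

text \<open>
  The tangent space at every point of \<open>\<real>\<^sup>7\<close> is \<open>\<real>\<^sup>7\<close>. The left-invariant vector field \<open>e\<^sub>i\<close> is
  obtained by differentiating the left translations at the identity \<open>0\<close>.
\<close>

definition frame :: "7 \<Rightarrow> heis \<Rightarrow> real^7" where
  "frame i x = frechet_derivative (heis_mult x) (at 0) (axis i 1)"

definition frame_deriv :: "7 \<Rightarrow> (heis \<Rightarrow> real) \<Rightarrow> heis \<Rightarrow> real" where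
  "frame_deriv i u x = frechet_derivative u (at x) (frame i x)"

definition lie_bracket :: "(heis \<Rightarrow> real^7) \<Rightarrow> (heis \<Rightarrow> real^7) \<Rightarrow> heis \<Rightarrow> real^7" where
  "lie_bracket X Y x = frechet_derivative Y (at x) (X x) - frechet_derivative X (at x) (Y x)"

definition frame_comps :: "heis \<Rightarrow> real^7 \<Rightarrow> real^7" where
  "frame_comps x v = (THE c. v = (\<Sum>i\<in>UNIV. c$i *\<^sub>R frame i x))"

text \<open>\<open>[e\<^sub>i, e\<^sub>j] = \<Sum>\<^sub>k struct_coeff x i j k \<cdot> e\<^sub>k\<close> at the point \<open>x\<close>.\<close>

definition struct_coeff :: "heis \<Rightarrow> 7 \<Rightarrow> 7 \<Rightarrow> 7 \<Rightarrow> real" where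
  "struct_coeff x i j k = frame_comps x (lie_bracket (frame i) (frame j) x) $ k"


section \<open>Tensors and forms\<close>

text \<open>
  A covariant tensor of rank \<open>k\<close> at a point is represented by its components
  \<open>S [i\<^sub>1, \<dots>, i\<^sub>k] = S(e\<^sub>i\<^sub>1, \<dots>, e\<^sub>i\<^sub>k)\<close> with respect to the frame \<open>e\<^sub>1, \<dots>, e\<^sub>7\<close>, and a tensor field by
  its component functions on the group; only lists of length \<open>k\<close> are relevant. A tensor field is
  left-invariant iff its component functions are constant. Tensors of rank 2 are also written as
  matrices \<^typ>\<open>real^7^7\<close>.
\<close>

type_synonym tensor = "7 list \<Rightarrow> real"

definition mat_tensor :: "real^7^7 \<Rightarrow> tensor" where
  "mat_tensor A = (\<lambda>is. A $ (is!0) $ (is!1))"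

definition alternating :: "nat \<Rightarrow> tensor \<Rightarrow> bool" where
  "alternating k \<alpha> \<longleftrightarrow> (\<forall>is r s. length is = k \<and> r < s \<and> s < k \<longrightarrow>
      \<alpha> (is[r := is!s, s := is!r]) = - \<alpha> is)"

text \<open>
  Wedge product of a \<open>k\<close>-form \<open>\<alpha>\<close> with a form \<open>\<beta>\<close>, as the signed sum over shuffles (so that
  \<open>(e\<^sup>1 \<and> \<dots> \<and> e\<^sup>k)(e\<^sub>1, \<dots>, e\<^sub>k) = 1\<close>): the set \<open>A\<close> contains the positions of the arguments of \<open>\<alpha>\<close>, and
  the exponent is the number of inversions of the shuffle.
\<close>

definition wedge :: "nat \<Rightarrow> tensor \<Rightarrow> tensor \<Rightarrow> tensor" where
  "wedge k \<alpha> \<beta> is =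
     (\<Sum>A | A \<subseteq> {..<length is} \<and> card A = k.
        (-1) ^ card {(r, s). r \<in> A \<and> s \<in> {..<length is} - A \<and> s < r}
        * \<alpha> (nths is A) * \<beta> (nths is (- A)))"

definition coframe :: "7 \<Rightarrow> tensor" where
  "coframe i = (\<lambda>is. if is = [i] then 1 else 0)"

text \<open>\<open>e [i\<^sub>1, \<dots>, i\<^sub>k]\<close> is \<open>e\<^sup>i\<^sup>1 \<and> \<dots> \<and> e\<^sup>i\<^sup>k\<close>.\<close>

fun e :: "7 list \<Rightarrow> tensor" where
  "e [] = (\<lambda>is. if is = [] then 1 else 0)"
| "e (i # js) = wedge 1 (coframe i) (e js)"

definition interior :: "real^7 \<Rightarrow> tensor \<Rightarrow> tensor" where
  "interior X \<alpha> is = (\<Sum>p\<in>UNIV. X$p * \<alpha> (p # is))"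

text \<open>Components of the exterior derivative of a 1-form (a field of tensors of rank 1).\<close>

definition ext_deriv1 :: "(heis \<Rightarrow> tensor) \<Rightarrow> heis \<Rightarrow> 7 \<Rightarrow> 7 \<Rightarrow> real" where
  "ext_deriv1 \<alpha> x i j =
     frame_deriv i (\<lambda>y. \<alpha> y [j]) x - frame_deriv j (\<lambda>y. \<alpha> y [i]) x
     - (\<Sum>k\<in>UNIV. struct_coeff x i j k * \<alpha> x [k])"

coinductive smooth_fun :: "(heis \<Rightarrow> real) \<Rightarrow> bool" where
  "(\<And>x. u differentiable (at x)) \<Longrightarrow>
   (\<And>i. smooth_fun (\<lambda>x. frechet_derivative u (at x) (axis i 1))) \<Longrightarrow> smooth_fun u"


section \<open>Riemannian geometry in the frame\<close>

text \<open>The volume form for the orientation in which \<open>e\<^sub>1, \<dots>, e\<^sub>7\<close> is positive.\<close>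

definition vol_form :: "real^7^7 \<Rightarrow> tensor" where
  "vol_form g is = sqrt (det g) * e [1,2,3,4,5,6,7] is"

definition hodge :: "real^7^7 \<Rightarrow> nat \<Rightarrow> tensor \<Rightarrow> tensor" where
  "hodge g k \<gamma> is =
     (\<Sum>js | length js = k. \<Sum>ls | length ls = k.
        (\<Prod>r<k. matrix_inv g $ (js!r) $ (ls!r)) * \<gamma> ls * vol_form g (js @ is)) / fact k"

text \<open>
  The coefficients \<open>\<nabla>\<^bsub>e\<^sub>i\<^esub> e\<^sub>j = \<Sum>\<^sub>k \<Gamma> i j k \<cdot> e\<^sub>k\<close> of the Levi-Civita connection: the unique connection that
  is torsion-free, \<open>\<nabla>\<^bsub>e\<^sub>i\<^esub> e\<^sub>j - \<nabla>\<^bsub>e\<^sub>j\<^esub> e\<^sub>i = [e\<^sub>i, e\<^sub>j]\<close>, and metric,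
  \<open>e\<^sub>i (g (e\<^sub>j, e\<^sub>k)) = g (\<nabla>\<^bsub>e\<^sub>i\<^esub> e\<^sub>j, e\<^sub>k) + g (e\<^sub>j, \<nabla>\<^bsub>e\<^sub>i\<^esub> e\<^sub>k)\<close>.
\<close>

definition levi_civita :: "(heis \<Rightarrow> real^7^7) \<Rightarrow> heis \<Rightarrow> 7 \<Rightarrow> 7 \<Rightarrow> 7 \<Rightarrow> real" where
  "levi_civita g x = (THE \<Gamma>.
     (\<forall>i j k. \<Gamma> i j k - \<Gamma> j i k = struct_coeff x i j k) \<and>
     (\<forall>i j k. frame_deriv i (\<lambda>y. g y $ j $ k) x =
        (\<Sum>l\<in>UNIV. \<Gamma> i j l * g x $ l $ k) + (\<Sum>l\<in>UNIV. \<Gamma> i k l * g x $ j $ l)))"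

text \<open>\<open>cov_deriv g S x m is\<close> is \<open>(\<nabla>\<^sub>m S)\<^bsub>is\<^esub>\<close> at \<open>x\<close>.\<close>

definition cov_deriv :: "(heis \<Rightarrow> real^7^7) \<Rightarrow> (heis \<Rightarrow> tensor) \<Rightarrow> heis \<Rightarrow> 7 \<Rightarrow> tensor" where
  "cov_deriv g S x m is =
     frame_deriv m (\<lambda>y. S y is) x
     - (\<Sum>r<length is. \<Sum>p\<in>UNIV. levi_civita g x m (is!r) p * S x (is[r := p]))"

text \<open>
  \<open>riemann g x i j k l\<close> is the \<open>e\<^sub>l\<close>-component of
  \<open>R(e\<^sub>i, e\<^sub>j) e\<^sub>k = \<nabla>\<^bsub>e\<^sub>i\<^esub> \<nabla>\<^bsub>e\<^sub>j\<^esub> e\<^sub>k - \<nabla>\<^bsub>e\<^sub>j\<^esub> \<nabla>\<^bsub>e\<^sub>i\<^esub> e\<^sub>k - \<nabla>\<^bsub>[e\<^sub>i, e\<^sub>j]\<^esub> e\<^sub>k\<close>, and \<open>Ric(Y, Z)\<close> is the trace of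
  \<open>X \<mapsto> R(X, Y) Z\<close>.
\<close>

definition riemann :: "(heis \<Rightarrow> real^7^7) \<Rightarrow> heis \<Rightarrow> 7 \<Rightarrow> 7 \<Rightarrow> 7 \<Rightarrow> 7 \<Rightarrow> real" where
  "riemann g x i j k l =
     frame_deriv i (\<lambda>y. levi_civita g y j k l) x - frame_deriv j (\<lambda>y. levi_civita g y i k l) x
     + (\<Sum>m\<in>UNIV. levi_civita g x j k m * levi_civita g x i m l
                - levi_civita g x i k m * levi_civita g x j m l
                - struct_coeff x i j m * levi_civita g x m k l)"

definition ricci :: "(heis \<Rightarrow> real^7^7) \<Rightarrow> heis \<Rightarrow> real^7^7" where
  "ricci g x = (\<chi> j k. \<Sum>i\<in>UNIV. riemann g x i j k i)"

text \<open>\<open>(div T)\<^sub>i = \<nabla>\<^sup>j T\<^bsub>ji\<^esub>\<close>\<close>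

definition divergence :: "(heis \<Rightarrow> real^7^7) \<Rightarrow> (heis \<Rightarrow> real^7^7) \<Rightarrow> heis \<Rightarrow> real^7" where
  "divergence g T x = (\<chi> i. \<Sum>j\<in>UNIV. \<Sum>k\<in>UNIV.
     matrix_inv (g x) $ j $ k * cov_deriv g (\<lambda>y. mat_tensor (T y)) x k [j, i])"

definition diamond :: "real^7^7 \<Rightarrow> real^7^7 \<Rightarrow> tensor \<Rightarrow> tensor" where
  "diamond g A \<gamma> is =
     (\<Sum>r<length is. \<Sum>p\<in>UNIV. \<Sum>q\<in>UNIV. A $ (is!r) $ q * matrix_inv g $ q $ p * \<gamma> (is[r := p]))"


section \<open>G2-structures and the Ricci-harmonic flow\<close>

text \<open>
  \<open>(X \<lrcorner> \<phi>) \<and> (Y \<lrcorner> \<phi>) \<and> \<phi> = 6 g(X, Y) vol\<^sub>g\<close>, with both 7-forms evaluated at \<open>(e\<^sub>1, \<dots>, e\<^sub>7)\<close>. For given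
  \<open>\<phi>\<close> there is at most one such \<open>g\<close>.
\<close>

definition is_G2_metric :: "tensor \<Rightarrow> real^7^7 \<Rightarrow> bool" where
  "is_G2_metric \<phi> g \<longleftrightarrow>
     transpose g = g \<and> (\<forall>v. v \<noteq> 0 \<longrightarrow> v \<bullet> (g *v v) > 0) \<and>
     (\<forall>X Y. wedge 4 (wedge 2 (interior X \<phi>) (interior Y \<phi>)) \<phi> [1,2,3,4,5,6,7] =
        6 * (X \<bullet> (g *v Y)) * vol_form g [1,2,3,4,5,6,7])"

definition G2_metric :: "tensor \<Rightarrow> real^7^7" where
  "G2_metric \<phi> = (THE g. is_G2_metric \<phi> g)"

definition G2_structure :: "(heis \<Rightarrow> tensor) \<Rightarrow> bool" where
  "G2_structure \<phi> \<longleftrightarrow>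
     (\<forall>i j k. smooth_fun (\<lambda>x. \<phi> x [i, j, k])) \<and>
     (\<forall>x. alternating 3 (\<phi> x) \<and> (\<exists>g. is_G2_metric (\<phi> x) g))"

definition G2_psi :: "tensor \<Rightarrow> tensor" where
  "G2_psi \<phi> = hodge (G2_metric \<phi>) 3 \<phi>"

text \<open>\<open>\<nabla>\<^sub>m \<phi>\<^bsub>ijk\<^esub> = T\<^sub>m\<^sup>p \<psi>\<^bsub>pijk\<^esub>\<close> determines \<open>T\<close> uniquely.\<close>

definition G2_torsion :: "(heis \<Rightarrow> tensor) \<Rightarrow> heis \<Rightarrow> real^7^7" where
  "G2_torsion \<phi> x = (THE T. \<forall>m i j k.
     cov_deriv (\<lambda>y. G2_metric (\<phi> y)) \<phi> x m [i, j, k] =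
     (\<Sum>p\<in>UNIV. \<Sum>q\<in>UNIV. T $ m $ q * matrix_inv (G2_metric (\<phi> x)) $ q $ p
        * G2_psi (\<phi> x) [p, i, j, k]))"

text \<open>\<open>(T\<^sup>t T)\<^bsub>ij\<^esub> = T\<^sup>k\<^sub>i T\<^bsub>kj\<^esub>\<close> and \<open>|T|\<^sup>2 = T\<^bsub>ij\<^esub> T\<^sup>i\<^sup>j\<close>, with indices raised by \<open>g\<close>.\<close>

definition tensor_TtT :: "real^7^7 \<Rightarrow> real^7^7 \<Rightarrow> real^7^7" where
  "tensor_TtT g T = (\<chi> i j. \<Sum>k\<in>UNIV. \<Sum>l\<in>UNIV. matrix_inv g $ k $ l * T $ l $ i * T $ k $ j)"

definition tensor_norm2 :: "real^7^7 \<Rightarrow> real^7^7 \<Rightarrow> real" where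
  "tensor_norm2 g T = (\<Sum>i\<in>UNIV. \<Sum>j\<in>UNIV. \<Sum>k\<in>UNIV. \<Sum>l\<in>UNIV.
     T $ i $ j * matrix_inv g $ i $ k * matrix_inv g $ j $ l * T $ k $ l)"

definition ricci_harmonic_rhs :: "(heis \<Rightarrow> tensor) \<Rightarrow> heis \<Rightarrow> tensor" where
  "ricci_harmonic_rhs \<phi> x is =
     (let g = (\<lambda>y. G2_metric (\<phi> y)); T = G2_torsion \<phi> in
        diamond (g x)
          (- ricci g x + 3 *\<^sub>R tensor_TtT (g x) (T x) - tensor_norm2 (g x) (T x) *\<^sub>R g x) (\<phi> x) is
        + interior (matrix_inv (g x) *v divergence g T x) (G2_psi (\<phi> x)) is)"

definition ricci_harmonic_flow ::
    "real set \<Rightarrow> (real \<Rightarrow> heis \<Rightarrow> tensor) \<Rightarrow> (heis \<Rightarrow> tensor) \<Rightarrow> bool" where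
  "ricci_harmonic_flow I \<phi> \<phi>\<^sub>0 \<longleftrightarrow>
     (\<forall>t\<in>I. G2_structure (\<phi> t)) \<and>
     (\<forall>t\<in>I. \<forall>x i j k. ((\<lambda>s. \<phi> s x [i, j, k]) has_real_derivative
        ricci_harmonic_rhs (\<phi> t) x [i, j, k]) (at t within I)) \<and>
     (\<forall>x i j k. \<phi> 0 x [i, j, k] = \<phi>\<^sub>0 x [i, j, k])"

text \<open>Smoothness on an interval (one-sided derivatives at end points that belong to it).\<close>

definition smooth_on_interval :: "real set \<Rightarrow> (real \<Rightarrow> real) \<Rightarrow> bool" where
  "smooth_on_interval I u \<longleftrightarrow> (\<exists>D. D 0 = u \<and>
     (\<forall>n::nat. \<forall>t\<in>I. (D n has_real_derivative D (Suc n) t) (at t within I)))"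


section \<open>The group law and the structure equations\<close>

lemma UNIV_7: "(UNIV :: 7 set) = {1,2,3,4,5,6,7}"
proof -
  have "card {1,2,3,4,5,6,7::7} = CARD(7)" by simp
  then show ?thesis by (metis card_subset_eq finite subset_UNIV)
qed

lemma sum_7: "(\<Sum>i\<in>UNIV. u (i::7)) = u 1 + u 2 + u 3 + u 4 + u 5 + u 6 + (u 7 :: 'a::ab_group_add)"
  unfolding UNIV_7 by (simp add: add.assoc)

lemma forall_7: "(\<forall>i::7. P i) \<longleftrightarrow> P 1 \<and> P 2 \<and> P 3 \<and> P 4 \<and> P 5 \<and> P 6 \<and> P 7"
proof -
  have "(\<forall>i::7. P i) \<longleftrightarrow> (\<forall>i\<in>UNIV. P i)" by simp
  then show ?thesis unfolding UNIV_7 by simp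
qed

lemma bounded_linear_heis_bracket: "bounded_linear (heis_bracket x)"
  unfolding heis_bracket_def by (intro linear_conv_bounded_linear[THEN iffD1] linearI)
    (simp_all add: algebra_simps flip: scaleR_add_left)


lemma heis_mult_assoc: "heis_mult (heis_mult x y) z = heis_mult x (heis_mult y z)"
  unfolding heis_mult_def heis_bracket_def
  by (simp add: vec_eq_iff forall_7 axis_def algebra_simps)

lemma heis_mult_neutral: "heis_mult 0 x = x" "heis_mult x 0 = x"
  unfolding heis_mult_def heis_bracket_def by simp_all

lemma heis_mult_inverse: "heis_mult (- x) x = 0" "heis_mult x (- x) = 0"
  unfolding heis_mult_def heis_bracket_def by simp_all

lemma frechet_heis_mult: "frechet_derivative (heis_mult x) (at y) = (\<lambda>v. v + (1/2) *\<^sub>R heis_bracket x v)"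
proof -
  have "(heis_mult x has_derivative (\<lambda>v. v + (1/2) *\<^sub>R heis_bracket x v)) (at y)"
    unfolding heis_mult_def
    by (auto intro!: derivative_eq_intros bounded_linear.has_derivative[OF bounded_linear_heis_bracket])
  then show ?thesis by (rule frechet_derivative_at[symmetric])
qed

lemma frame_eq: "frame i x = axis i 1 + (1/2) *\<^sub>R heis_bracket x (axis i 1)"
  unfolding frame_def frechet_heis_mult ..

lemma frame_left_invariant:
  "frechet_derivative (heis_mult h) (at x) (frame i x) = frame i (heis_mult h x)"
  unfolding frechet_heis_mult frame_eq heis_mult_def heis_bracket_def
  by (simp add: vec_eq_iff forall_7 axis_def algebra_simps)

lemma lie_bracket_frame: "lie_bracket (frame i) (frame j) x = heis_bracket (axis i 1) (axis j 1)"
proof -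
  have skew: "heis_bracket u v = - heis_bracket v u" for u v
    unfolding heis_bracket_def by (simp add: algebra_simps flip: scaleR_minus_left)
  have bl: "bounded_linear (\<lambda>v. heis_bracket v u)" for u
    unfolding skew[of _ u] by (intro bounded_linear_minus bounded_linear_heis_bracket)
  have "(frame k has_derivative (\<lambda>v. (1/2) *\<^sub>R heis_bracket v (axis k 1))) (at x)" for k
    unfolding frame_eq[abs_def]
    by (auto intro!: derivative_eq_intros bounded_linear.has_derivative[OF bl])
  then have "frechet_derivative (frame k) (at x) = (\<lambda>v. (1/2) *\<^sub>R heis_bracket v (axis k 1))" for k
    by (rule frechet_derivative_at[symmetric])
  then show ?thesis
    unfolding lie_bracket_def frame_eq heis_bracket_def
    by (simp add: vec_eq_iff axis_def field_simps)
qed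

lemma lie_bracket_frame_nonzero:
  "lie_bracket (frame 1) (frame 2) x = - frame 7 x"
  "lie_bracket (frame 3) (frame 4) x = - frame 7 x"
  "lie_bracket (frame 5) (frame 6) x = - frame 7 x"
  unfolding lie_bracket_frame frame_eq heis_bracket_def
  by (simp_all add: vec_eq_iff forall_7 axis_def)

lemma frame_comps_unique:
  assumes "v = (\<Sum>i\<in>UNIV. d$i *\<^sub>R frame i x)"
  shows "frame_comps x v = d"
  unfolding frame_comps_def
proof (rule the_equality[where P = "\<lambda>d. v = (\<Sum>i\<in>UNIV. d$i *\<^sub>R frame i x)", OF assms])
  fix d'
  assume "v = (\<Sum>i\<in>UNIV. d'$i *\<^sub>R frame i x)"
  with assms have "\<forall>k. (\<Sum>i\<in>UNIV. d'$i *\<^sub>R frame i x) $ k = (\<Sum>i\<in>UNIV. d$i *\<^sub>R frame i x) $ k"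
    by simp
  then show "d' = d"
    unfolding vec_eq_iff forall_7 sum_7 frame_eq heis_bracket_def
    by (auto simp: axis_def)
qed

lemma struct_coeff_eq:
  "struct_coeff x i j k =
     (if k = 7 then
        (if (i, j) \<in> {(1,2), (3,4), (5,6)} then -1
         else if (j, i) \<in> {(1,2), (3,4), (5,6)} then 1 else 0)
      else 0)"
proof -
  let ?B = "heis_bracket (axis i 1) (axis j 1)"
  have "frame_comps x ?B = ?B"
    by (rule frame_comps_unique)
      (simp add: sum_7 frame_eq heis_bracket_def vec_eq_iff forall_7 axis_def)
  then have "struct_coeff x i j k = ?B $ k"
    unfolding struct_coeff_def lie_bracket_frame by simp
  moreover have "\<forall>i j. heis_bracket (axis i 1) (axis j 1) $ k =
     (if k = 7 then
        (if (i, j) \<in> {(1,2), (3,4), (5,6)} then -1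
         else if (j, i) \<in> {(1,2), (3,4), (5,6)} then 1 else 0)
      else 0)"
    unfolding forall_7 heis_bracket_def by (simp add: axis_def)
  ultimately show ?thesis by (simp only:)
qed

lemma frame_deriv_const: "frame_deriv i (\<lambda>x. u) x = 0"
  unfolding frame_deriv_def by simp

lemma e_single: "e [i] [j] = (if i = j then 1 else 0)"
proof -
  have *: "{A. A \<subseteq> {..<1::nat} \<and> card A = 1} = {{0}}"
    by (auto simp: card_1_singleton_iff lessThan_Suc)
  show ?thesis
    using * by (auto simp: wedge_def coframe_def nths_Cons lessThan_Suc)
qed

lemma e_pair: "e [i, j] [k, l] = (if i = k \<and> j = l then 1 else 0) - (if i = l \<and> j = k then 1 else 0)"
proof -
  have A: "{A. A \<subseteq> {..<length [k, l]} \<and> card A = 1} = {{0}, {1}}"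
    by (auto simp: card_1_singleton_iff lessThan_Suc)
  have B0: "card {(r, s). r \<in> {0} \<and> s \<in> {..<length [k, l]} - {0} \<and> s < r} = 0"
    by (auto simp: card_eq_0_iff)
  have "{(r, s). r \<in> {1} \<and> s \<in> {..<length [k, l]} - {1} \<and> s < r} = {(1, 0)}"
    by auto
  then have B1: "card {(r, s). r \<in> {1} \<and> s \<in> {..<length [k, l]} - {1} \<and> s < r} = 1"
    by simp
  have two: "(\<Sum>A\<in>{{0}, {1::nat}}. F A) = F {0} + (F {1} :: real)" for F
    by simp
  have "e [i, j] [k, l] = wedge 1 (coframe i) (e [j]) [k, l]"
    by (rule e.simps(2)[THEN fun_cong])
  also have "\<dots> = coframe i [k] * e [j] [l] - coframe i [l] * e [j] [k]"
    unfolding wedge_def A two B0 B1 by (simp add: nths_Cons del: e.simps)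
  finally have "e [i, j] [k, l] = coframe i [k] * e [j] [l] - coframe i [l] * e [j] [k]" .
  then show ?thesis
    unfolding e_single coframe_def
    by (cases "i = k"; cases "i = l"; cases "j = l"; cases "j = k"; simp del: e.simps)
qed

lemma ext_deriv_coframe:
  "ext_deriv1 (\<lambda>x. e [i]) x j k =
     (if i = 7 then e [1,2] [j,k] + e [3,4] [j,k] + e [5,6] [j,k] else 0)"
proof -
  have "ext_deriv1 (\<lambda>x. e [i]) x j k = - struct_coeff x j k i"
    unfolding ext_deriv1_def frame_deriv_const e_single by (simp add: if_distrib[of "times _"] cong: if_cong)
  then show ?thesis
    unfolding struct_coeff_eq e_pair by (auto split: if_splits)
qed

end

theory Submission
  imports Defs
begin

text \<open>
  All tensors in question are left-invariant, so in the frame \<open>e\<^sub>1, \<dots>, e\<^sub>7\<close> they have constant components,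
  and at each time the flow equation is an algebraic identity between constant tensors. Write
  \<open>p = 1/a\<^sup>2\<close>, \<open>q = 1/b\<^sup>2\<close>, \<open>r = 1/c\<^sup>2\<close>.

  The 3-form \<open>\<phi>\<close> is built so that its metric is diagonal in the frame (\<open>G2_metric_phi\<close>), with entries
  \<open>a\<^sup>2, a\<^sup>2, b\<^sup>2, b\<^sup>2, c\<^sup>2, c\<^sup>2, f\<^sup>2\<close>. For a diagonal metric the Koszul formula gives the Levi-Civita coefficients
  from the structure constants (\<open>levi_civita_diag_mat\<close>). A connection acts on \<open>\<phi>\<close> as a derivation, and
  it turns out that \<open>\<nabla>\<^sub>m \<phi>\<close> is a multiple of \<open>e\<^sub>m \<lrcorner> \<psi>\<close> for every \<open>m\<close> (\<open>cov_deriv_phi\<close>). Hence the torsion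
  is diagonal too (\<open>torsion_phi\<close>): relative to the metric its eigenvalues are \<open>f p/2\<close>, \<open>f q/2\<close>, \<open>f r/2\<close>,
  each twice, and \<open>-f (p + q + r)/2\<close>.

  The Ricci tensor is diagonal as well (\<open>ricci_phi\<close>), and \<open>div T = 0\<close> (\<open>divergence_phi\<close>) because a diagonal
  tensor only meets the coefficients \<open>\<Gamma> j j i\<close> and \<open>\<Gamma> j i j\<close>, all of which vanish. So the right-hand side of
  the flow is the action of a diagonal endomorphism on \<open>\<phi>\<close>, which multiplies each decomposable
  form \<open>e\<^sup>i\<^sup>j\<^sup>k\<close> by the sum of the three eigenvalues involved (\<open>diamond_diag_mat_e3\<close>). These sums are
  \<open>f\<^sup>2 (p\<^sup>2/2 - 2 q\<^sup>2 - 2 r\<^sup>2)\<close> for \<open>e\<^sup>1\<^sup>2\<^sup>7\<close>, the analogous expressions for \<open>e\<^sup>3\<^sup>4\<^sup>7\<close> and \<open>e\<^sup>5\<^sup>6\<^sup>7\<close>, and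
  \<open>-f\<^sup>2 (p\<^sup>2 + q\<^sup>2 + r\<^sup>2 + 3/2 (p q + p r + q r))\<close> for all of the four remaining forms. The right-hand side
  is therefore of the same shape as \<open>\<phi>\<close> (\<open>ricci_harmonic_rhs_phi\<close>), and comparing the coefficients of the
  linearly independent forms yields the four differential equations.
\<close>

declare e.simps(2) [simp del]

section \<open>Wedge products, one argument at a time\<close>

lemma inversions_insert_0:
  "{(r, s). r \<in> insert 0 (Suc ` B) \<and> s \<in> {..<Suc n} - insert 0 (Suc ` B) \<and> s < r} =
     map_prod Suc Suc ` {(r, s). r \<in> B \<and> s \<in> {..<n} - B \<and> s < r}"
proof -
  have "(r, s) \<in> map_prod Suc Suc ` {(r, s). r \<in> B \<and> s \<in> {..<n} - B \<and> s < r}"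
    if "r \<in> insert 0 (Suc ` B)" "s \<in> {..<Suc n} - insert 0 (Suc ` B)" "s < r" for r s
    using that by (cases r; cases s) (auto simp: image_iff map_prod_def)
  then show ?thesis by auto
qed

lemma inversions_Suc_image:
  "{(r, s). r \<in> Suc ` B \<and> s \<in> {..<Suc n} - Suc ` B \<and> s < r} =
     (\<lambda>r. (Suc r, 0)) ` B \<union> map_prod Suc Suc ` {(r, s). r \<in> B \<and> s \<in> {..<n} - B \<and> s < r}"
proof -
  have "(r, s) \<in> (\<lambda>r. (Suc r, 0)) ` B \<union> map_prod Suc Suc ` {(r, s). r \<in> B \<and> s \<in> {..<n} - B \<and> s < r}"
    if "r \<in> Suc ` B" "s \<in> {..<Suc n} - Suc ` B" "s < r" for r s
    using that by (cases r; cases s) (auto simp: image_iff map_prod_def)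
  then show ?thesis by auto
qed

lemma subsets_lessThan_Suc:
  "{A. A \<subseteq> {..<Suc n} \<and> card A = k} =
     (\<lambda>B. insert 0 (Suc ` B)) ` {B. B \<subseteq> {..<n} \<and> Suc (card B) = k} \<union>
     (`) Suc ` {B. B \<subseteq> {..<n} \<and> card B = k}" (is "?L = ?R")
proof (intro set_eqI iffI)
  fix A assume A: "A \<in> ?L"
  define B where "B = {j. Suc j \<in> A}"
  have B: "B \<subseteq> {..<n}" using A by (auto simp: B_def)
  then have finB: "finite B" by (rule finite_subset) simp
  have Suc_B: "Suc x \<in> A \<longleftrightarrow> x \<in> B" for x by (simp add: B_def)
  show "A \<in> ?R"
  proof (cases "0 \<in> A")
    case True
    have *: "A = insert 0 (Suc ` B)"
    proof (rule set_eqI)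
      show "x \<in> A \<longleftrightarrow> x \<in> insert 0 (Suc ` B)" for x
        using True Suc_B by (cases x) auto
    qed
    have "card A = Suc (card B)"
      unfolding * using finB by (simp add: card_image)
    with A have "B \<in> {B. B \<subseteq> {..<n} \<and> Suc (card B) = k}" using B by simp
    then show ?thesis unfolding * by blast
  next
    case False
    have *: "A = Suc ` B"
    proof (rule set_eqI)
      show "x \<in> A \<longleftrightarrow> x \<in> Suc ` B" for x
        using False Suc_B by (cases x) auto
    qed
    have "card A = card B"
      unfolding * by (simp add: card_image)
    with A have "B \<in> {B. B \<subseteq> {..<n} \<and> card B = k}" using B by simp
    then show ?thesis unfolding * by blast
  qed
next
  fix A assume "A \<in> ?R"
  then show "A \<in> ?L"
    by (auto simp: card_image finite_subset)
qed

lemma wedge_0: "wedge 0 \<alpha> \<beta> is = \<alpha> [] * \<beta> is"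
proof -
  have "{A. A \<subseteq> {..<length is} \<and> card A = 0} = {{}}"
    by (auto dest: finite_subset)
  moreover have "nths is UNIV = is" by (simp add: nths_all)
  ultimately show ?thesis by (simp add: wedge_def)
qed

lemma wedge_Suc_Nil: "wedge (Suc k) \<alpha> \<beta> [] = 0"
  by (auto simp: wedge_def intro!: sum.neutral)

text \<open>
  Interior multiplication is an antiderivation: the first argument of \<open>\<alpha> \<and> \<beta>\<close> goes either to \<open>\<alpha>\<close>, or to \<open>\<beta>\<close>
  past the \<open>k + 1\<close> arguments of \<open>\<alpha>\<close>. Together with the two preceding lemmas this evaluates wedge
  products on explicit lists without enumerating shuffles.
\<close>

lemma wedge_Suc_Cons:
  "wedge (Suc k) \<alpha> \<beta> (x # xs) =
     wedge k (\<lambda>is. \<alpha> (x # is)) \<beta> xs + (-1) ^ Suc k * wedge (Suc k) \<alpha> (\<lambda>is. \<beta> (x # is)) xs"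
proof -
  define n where "n = length xs"
  let ?S = "\<lambda>k. {B. B \<subseteq> {..<n} \<and> card B = k}"
  let ?inv = "\<lambda>n B. card {(r, s). r \<in> B \<and> s \<in> {..<n} - B \<and> s < r}"
  let ?F = "\<lambda>A. (-1) ^ ?inv (Suc n) A * \<alpha> (nths (x # xs) A) * \<beta> (nths (x # xs) (- A))"
  have fin: "finite (?S j)" for j by simp
  have fin_inv: "finite {(r, s). r \<in> B \<and> s \<in> {..<n} - B \<and> s < r}" if "B \<subseteq> {..<n}" for B
    by (rule finite_subset[of _ "{..<n} \<times> {..<n}"]) (use that in auto)
  have inj1: "inj_on (\<lambda>B. insert 0 (Suc ` B)) (?S j)" for j
    by (rule inj_onI) (metis (no_types, lifting) Diff_insert_absorb inj_Suc inj_image_eq_iff nat.simps(3) image_iff)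
  have inj2: "inj_on ((`) Suc) (?S j)" for j
    by (rule inj_onI) (simp add: inj_image_eq_iff)
  have "wedge (Suc k) \<alpha> \<beta> (x # xs) = (\<Sum>A\<in>{A. A \<subseteq> {..<Suc n} \<and> card A = Suc k}. ?F A)"
    by (simp add: wedge_def n_def)
  also have "\<dots> = (\<Sum>A\<in>(\<lambda>B. insert 0 (Suc ` B)) ` ?S k. ?F A) + (\<Sum>A\<in>(`) Suc ` ?S (Suc k). ?F A)"
    unfolding subsets_lessThan_Suc nat.inject by (intro sum.union_disjoint finite_imageI fin) auto
  also have "(\<Sum>A\<in>(\<lambda>B. insert 0 (Suc ` B)) ` ?S k. ?F A) = wedge k (\<lambda>is. \<alpha> (x # is)) \<beta> xs"
    unfolding sum.reindex[OF inj1] wedge_def n_def[symmetric] comp_def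
  proof (intro sum.cong refl)
    fix B assume "B \<in> ?S k"
    have "?inv (Suc n) (insert 0 (Suc ` B)) = ?inv n B"
      unfolding inversions_insert_0 by (rule card_image) (auto intro: inj_onI)
    moreover have "{j. Suc j \<in> insert 0 (Suc ` B)} = B" "{j. Suc j \<in> - insert 0 (Suc ` B)} = - B"
      by auto
    ultimately show "?F (insert 0 (Suc ` B)) =
        (-1) ^ ?inv n B * \<alpha> (x # nths xs B) * \<beta> (nths xs (- B))"
      by (simp only: nths_Cons) simp
  qed
  also have "(\<Sum>A\<in>(`) Suc ` ?S (Suc k). ?F A) =
      (-1) ^ Suc k * wedge (Suc k) \<alpha> (\<lambda>is. \<beta> (x # is)) xs"
    unfolding sum.reindex[OF inj2] wedge_def n_def[symmetric] comp_def sum_distrib_left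
  proof (intro sum.cong refl)
    fix B assume B: "B \<in> ?S (Suc k)"
    have "?inv (Suc n) (Suc ` B) = card ((\<lambda>r. (Suc r, 0::nat)) ` B) +
        card (map_prod Suc Suc ` {(r, s). r \<in> B \<and> s \<in> {..<n} - B \<and> s < r})"
      unfolding inversions_Suc_image using B fin_inv[of B]
      by (intro card_Un_disjoint finite_imageI) (auto intro: finite_subset)
    also have "card ((\<lambda>r. (Suc r, 0::nat)) ` B) = Suc k"
      using B by (subst card_image) (auto intro: inj_onI)
    also have "card (map_prod Suc Suc ` {(r, s). r \<in> B \<and> s \<in> {..<n} - B \<and> s < r}) = ?inv n B"
      by (rule card_image) (auto intro: inj_onI)
    finally have "?inv (Suc n) (Suc ` B) = Suc k + ?inv n B" .
    moreover have "{j. Suc j \<in> Suc ` B} = B" "{j. Suc j \<in> - Suc ` B} = - B"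
      by auto
    ultimately show "?F (Suc ` B) =
        (-1) ^ Suc k * ((-1) ^ ?inv n B * \<alpha> (nths xs B) * \<beta> (x # nths xs (- B)))"
      by (simp only: nths_Cons power_add) simp
  qed
  finally show ?thesis .
qed

lemma e_Cons_Cons:
  "e (i # js) (x # is) =
     (if i = x then e js is else 0) - wedge 1 (coframe i) (\<lambda>ks. e js (x # ks)) is"
  unfolding e.simps One_nat_def wedge_Suc_Cons wedge_0 by (simp add: coframe_def)

lemma wedge_1_Cons:
  "wedge 1 (coframe i) \<beta> (x # is) =
     (if i = x then \<beta> is else 0) - wedge 1 (coframe i) (\<lambda>ks. \<beta> (x # ks)) is"
  unfolding One_nat_def wedge_Suc_Cons wedge_0 by (simp add: coframe_def)

lemma wedge_scale_right: "wedge k \<alpha> (\<lambda>is. r * \<beta> is) is = r * wedge k \<alpha> \<beta> is"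
  unfolding wedge_def sum_distrib_left by (simp add: algebra_simps)

lemma e_zero: "x \<notin> set js \<Longrightarrow> e js (x # is) = 0"
proof (induction js arbitrary: "is")
  case Nil
  then show ?case by simp
next
  case (Cons i js)
  have "(\<lambda>ks. e js (x # ks)) = (\<lambda>ks. 0)" using Cons by auto
  then have "wedge 1 (coframe i) (\<lambda>ks. e js (x # ks)) is = 0"
    using wedge_scale_right[of 1 "coframe i" 0 "\<lambda>_. 0" "is"] by simp
  with Cons.prems show ?case by (auto simp add: e_Cons_Cons simp del: One_nat_def)
qed

text \<open>
  The sign counts the covectors that \<open>e\<^sub>x\<close> has to pass before it meets \<open>e\<^sup>x\<close>. On explicit lists this rule
  computes every component of a basis form.
\<close>

lemma e_interior:
  assumes "distinct js"
  shows "e js (x # is) =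
    (if x \<in> set js then (-1) ^ length (takeWhile (\<lambda>i. i \<noteq> x) js) * e (remove1 x js) is else 0)"
  using assms
proof (induction js arbitrary: "is")
  case Nil
  then show ?case by simp
next
  case (Cons i js)
  show ?case
  proof (cases "i = x")
    case True
    then have "(\<lambda>ks. e js (x # ks)) = (\<lambda>ks. 0)" using Cons.prems e_zero by auto
    then have "wedge 1 (coframe i) (\<lambda>ks. e js (x # ks)) is = 0"
      using wedge_scale_right[of 1 "coframe i" 0 "\<lambda>_. 0" "is"] by simp
    with True show ?thesis by (simp add: e_Cons_Cons del: One_nat_def)
  next
    case False
    show ?thesis
    proof (cases "x \<in> set js")
      case True
      then have "e (i # js) (x # is) = - wedge 1 (coframe i)
          (\<lambda>ks. (-1) ^ length (takeWhile (\<lambda>i. i \<noteq> x) js) * e (remove1 x js) ks) is"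
        using False Cons by (simp add: e_Cons_Cons)
      then show ?thesis
        using True False by (simp add: wedge_scale_right e.simps(2))
    qed (use False in \<open>simp add: e_zero\<close>)
  qed
qed

lemma wedge_1_swap:
  assumes "\<And>us vs x y. \<beta> (us @ x # y # vs) = - \<beta> (us @ y # x # vs)"
  shows "wedge 1 (coframe i) \<beta> (us @ x # y # vs) = - wedge 1 (coframe i) \<beta> (us @ y # x # vs)"
  using assms
proof (induction us arbitrary: \<beta>)
  case Nil
  have "(\<lambda>ks. \<beta> (x # y # ks)) = (\<lambda>ks. - \<beta> (y # x # ks))"
    by (rule ext) (use Nil[of "[]" x y] in simp)
  then have "wedge 1 (coframe i) (\<lambda>ks. \<beta> (x # y # ks)) vs = - wedge 1 (coframe i) (\<lambda>ks. \<beta> (y # x # ks)) vs"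
    using wedge_scale_right[of 1 "coframe i" "-1" "\<lambda>ks. \<beta> (y # x # ks)" vs] by simp
  then show ?case by (simp add: wedge_1_Cons del: One_nat_def)
next
  case (Cons u us)
  have "\<beta> (u # us @ x # y # vs) = - \<beta> (u # us @ y # x # vs)" for us vs x y
    by (use Cons.prems[of "u # us" x y vs] in simp)
  then have "wedge 1 (coframe i) (\<lambda>ks. \<beta> (u # ks)) (us @ x # y # vs) =
      - wedge 1 (coframe i) (\<lambda>ks. \<beta> (u # ks)) (us @ y # x # vs)"
    by (rule Cons.IH)
  then show ?case
    by (simp add: wedge_1_Cons Cons.prems[of us x y vs] del: One_nat_def)
qed

lemma e_swap: "e js (us @ x # y # vs) = - e js (us @ y # x # vs)"
proof (induction js arbitrary: us x y vs)
  case (Cons i js)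
  show ?case unfolding e.simps(2) by (rule wedge_1_swap) (rule Cons.IH)
qed simp

section \<open>Basis 3-forms\<close>

text \<open>
  The Leibniz formula for a \<open>3 \<times> 3\<close> determinant. Each term is a product of three factors, associated to
  the right, which is the form that the rules \<open>sum_of_bool\<close> contract.
\<close>

lemma e3: "e [i, j, k] [l, m, n] =
   of_bool (i = l) * (of_bool (j = m) * of_bool (k = n))
 - of_bool (i = l) * (of_bool (j = n) * of_bool (k = m))
 - of_bool (i = m) * (of_bool (j = l) * of_bool (k = n))
 + of_bool (i = m) * (of_bool (j = n) * of_bool (k = l))
 + of_bool (i = n) * (of_bool (j = l) * of_bool (k = m))
 - of_bool (i = n) * (of_bool (j = m) * of_bool (k = l))"
proof -
  have if_of_bool: "(if P then r else 0) = of_bool P * r" for P and r :: real by simp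
  show ?thesis
    unfolding e.simps(2)[of i] wedge_1_Cons e_pair
    unfolding One_nat_def wedge_Suc_Nil
    unfolding if_of_bool of_bool_conj
    by (simp only: mult_1_right diff_0_right right_diff_distrib)
qed

lemma sum_of_bool:
  fixes u :: "'n::finite \<Rightarrow> real"
  shows "(\<Sum>p\<in>UNIV. u p * (of_bool (i = p) * y)) = u i * y"
    and "(\<Sum>p\<in>UNIV. u p * (y * (of_bool (i = p) * z))) = u i * (y * z)"
    and "(\<Sum>p\<in>UNIV. u p * (y * (z * of_bool (i = p)))) = u i * (y * z)"
    and "(\<Sum>p\<in>UNIV. u p * (of_bool (p = i) * y)) = u i * y"
    and "(\<Sum>p\<in>UNIV. u p * (y * (of_bool (p = i) * z))) = u i * (y * z)"
    and "(\<Sum>p\<in>UNIV. u p * (y * (z * of_bool (p = i)))) = u i * (y * z)"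
proof -
  have *: "of_bool (i = p) = (if p = i then 1 else (0::real))" "of_bool (p = i) = (if p = i then 1 else (0::real))" for p
    by auto
  show "(\<Sum>p\<in>UNIV. u p * (of_bool (i = p) * y)) = u i * y"
    and "(\<Sum>p\<in>UNIV. u p * (y * (of_bool (i = p) * z))) = u i * (y * z)"
    and "(\<Sum>p\<in>UNIV. u p * (y * (z * of_bool (i = p)))) = u i * (y * z)"
    and "(\<Sum>p\<in>UNIV. u p * (of_bool (p = i) * y)) = u i * y"
    and "(\<Sum>p\<in>UNIV. u p * (y * (of_bool (p = i) * z))) = u i * (y * z)"
    and "(\<Sum>p\<in>UNIV. u p * (y * (z * of_bool (p = i)))) = u i * (y * z)"
    unfolding * by (simp_all add: mult_delta_left mult_delta_right)
qed

text \<open>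
  An endomorphism acts as a derivation on covectors. The left side is the action on the arguments of a
  3-form, the right side the action on the factors \<open>e\<^sup>i\<close>, \<open>e\<^sup>j\<close>, \<open>e\<^sup>k\<close>; this turns covariant derivatives of
  3-forms into combinations of basis 3-forms.
\<close>

lemma e3_derivation:
  "(\<Sum>p\<in>UNIV. A l p * e [i,j,k] [p,m,n]) + (\<Sum>p\<in>UNIV. A m p * e [i,j,k] [l,p,n])
     + (\<Sum>p\<in>UNIV. A n p * e [i,j,k] [l,m,p]) =
   (\<Sum>q\<in>UNIV. A q i * e [q,j,k] [l,m,n]) + (\<Sum>q\<in>UNIV. A q j * e [i,q,k] [l,m,n])
     + (\<Sum>q\<in>UNIV. A q k * e [i,j,q] [l,m,n])"
  by (simp only: e3 right_diff_distrib distrib_left sum_subtractf sum.distrib sum_of_bool)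

lemma e3_diagonal_derivation:
  "(s l + s m + s n) * e [i,j,k] [l,m,n] = (s i + s j + s k) * e [i,j,k] [l,m,n]"
  using e3_derivation[of "\<lambda>q p. if q = p then s q else 0" l i j k m n]
  by (simp add: mult_delta_left distrib_right)

lemma e3_contract:
  "(\<Sum>l\<in>UNIV. \<Sum>m\<in>UNIV. \<Sum>n\<in>UNIV. F l m n * e [i,j,k] [l,m,n]) =
     F i j k - F i k j - F j i k + F j k i + F k i j - F k j i"
proof -
  have *: "(\<Sum>p\<in>UNIV. u p * of_bool (i = p) * y) = u i * y"
      "(\<Sum>p\<in>UNIV. u p * (y * of_bool (i = p))) = u i * y"
      "(\<Sum>p\<in>UNIV. u p * of_bool (i = p)) = u i" for u and y :: real and i :: 7
    using sum_of_bool(1)[of u i y] sum_of_bool(1)[of u i 1] by (simp_all only: mult_1_right mult.assoc mult.commute[of y])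
  show ?thesis
    by (simp only: e3 right_diff_distrib distrib_left sum_subtractf sum.distrib sum_of_bool *)
qed

lemma e3_alternating: "alternating 3 (e [i,j,k])"
proof -
  have "e [i,j,k] (is[r := is!s, s := is!r]) = - e [i,j,k] is" if "length is = 3" "r < s" "s < 3" for "is" r s
  proof -
    from that(1) obtain l m n where "is": "is = [l,m,n]"
      by (auto simp: numeral_3_eq_3 length_Suc_conv)
    have "(r, s) \<in> {(0,1), (0,2), (1,2)}" using that(2,3) by auto
    then consider "r = 0" "s = 1" | "r = 0" "s = 2" | "r = 1" "s = 2" by auto
    then show ?thesis
      unfolding "is" by cases (simp_all add: numeral_2_eq_2, simp_all add: e3 ac_simps)
  qed
  then show ?thesis by (simp add: alternating_def)
qed

text \<open>
  Comparing ranks gives the usual order of the indices; the order of the type \<^typ>\<open>7\<close> puts \<open>7 = 0\<close> first.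
\<close>

definition rank7 :: "7 \<Rightarrow> nat" where
  "rank7 i = length (takeWhile (\<lambda>j. j \<noteq> i) [1,2,3,4,5,6,7])"

lemma rank7_simps:
  "rank7 1 = 0" "rank7 2 = 1" "rank7 3 = 2" "rank7 4 = 3" "rank7 5 = 4" "rank7 6 = 5" "rank7 7 = 6"
  by (simp_all add: rank7_def)

text \<open>
  Used from left to right, these rules bring basis 3-forms into increasing order.
\<close>

lemma e3_sort:
  "rank7 j < rank7 i \<Longrightarrow> e [i,j,k] [l,m,n] = - e [j,i,k] [l,m,n]"
  "rank7 k < rank7 j \<Longrightarrow> e [i,j,k] [l,m,n] = - e [i,k,j] [l,m,n]"
  "e [i,i,k] [l,m,n] = 0"
  "e [i,j,j] [l,m,n] = 0"
  unfolding e3 by (simp_all add: ac_simps)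

lemma sum_lists_Suc:
  "(\<Sum>js | length js = Suc n. F js) = (\<Sum>i\<in>UNIV. \<Sum>js | length js = n. F (i # js))"
    for F :: "'a::finite list \<Rightarrow> real"
proof -
  have "{js::'a list. length js = Suc n} = (\<lambda>(i, js). i # js) ` (UNIV \<times> {js. length js = n})"
    by (auto simp: length_Suc_conv)
  moreover have "inj_on (\<lambda>(i, js). i # js) (UNIV \<times> {js::'a list. length js = n})"
    by (auto intro: inj_onI)
  ultimately show ?thesis
    by (simp add: sum.reindex sum.cartesian_product split_def)
qed

lemma sum_lists_3:
  "(\<Sum>js | length js = 3. F js) = (\<Sum>i\<in>UNIV. \<Sum>j\<in>UNIV. \<Sum>k\<in>UNIV. F [i,j,k])"
    for F :: "'a::finite list \<Rightarrow> real"
  by (simp add: numeral_3_eq_3 sum_lists_Suc)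

section \<open>Diagonal metrics\<close>

definition diag_mat :: "('n \<Rightarrow> real) \<Rightarrow> real^'n^'n::finite" where
  "diag_mat w = (\<chi> i j. if i = j then w i else 0)"

lemma diag_mat_nth: "diag_mat w $ i $ j = (if i = j then w i else 0)"
  by (simp add: diag_mat_def)

lemma sum_diag_mat: "(\<Sum>p\<in>UNIV. diag_mat u $ i $ p * F p) = u i * F i"
  "(\<Sum>p\<in>UNIV. diag_mat u $ p $ i * F p) = u i * F i"
  by (simp_all add: diag_mat_nth mult_delta_left)

lemma matrix_inv_diag_mat:
  assumes "\<And>i. w i \<noteq> 0"
  shows "matrix_inv (diag_mat w) = diag_mat (\<lambda>i. inverse (w i))"
proof -
  have inv: "diag_mat w ** diag_mat (\<lambda>i. inverse (w i)) = mat 1"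
    "diag_mat (\<lambda>i. inverse (w i)) ** diag_mat w = mat 1"
    using assms by (simp_all add: vec_eq_iff matrix_matrix_mult_def diag_mat_def mat_def mult_delta_left mult_delta_right)
  show ?thesis
    unfolding matrix_inv_def
  proof (rule some_equality)
    fix B assume "diag_mat w ** B = mat 1 \<and> B ** diag_mat w = mat 1"
    then show "B = diag_mat (\<lambda>i. inverse (w i))"
      using inv by (metis matrix_mul_assoc matrix_mul_lid matrix_mul_rid)
  qed (use inv in blast)
qed

lemma det_diag_mat: "det (diag_mat w) = prod w UNIV"
  by (subst det_diagonal) (simp_all add: diag_mat_def)

lemma matrix_form_diag_mat: "X \<bullet> (diag_mat w *v Y) = (\<Sum>i\<in>UNIV. w i * X $ i * Y $ i)"
  by (simp add: inner_vec_def matrix_vector_mult_def diag_mat_nth mult_delta_left)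
    (simp add: ac_simps)

lemma diamond_add: "diamond g A (\<lambda>js. \<alpha> js + \<beta> js) is = diamond g A \<alpha> is + diamond g A \<beta> is"
  unfolding diamond_def by (simp add: distrib_left sum.distrib)

lemma diamond_scale: "diamond g A (\<lambda>js. r * \<alpha> js) is = r * diamond g A \<alpha> is"
  unfolding diamond_def by (simp add: sum_distrib_left ac_simps)

lemma diamond_diff: "diamond g A (\<lambda>js. \<alpha> js - \<beta> js) is = diamond g A \<alpha> is - diamond g A \<beta> is"
  using diamond_add[of g A \<alpha> "\<lambda>js. -1 * \<beta> js" "is"] unfolding diamond_scale by simp

lemma diamond_diag_mat:
  assumes "\<And>i. w i \<noteq> 0"
  shows "diamond (diag_mat w) (diag_mat v) \<gamma> is = (\<Sum>r<length is. v (is!r) / w (is!r)) * \<gamma> is"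
proof -
  have "(\<Sum>p\<in>UNIV. \<Sum>q\<in>UNIV. diag_mat v $ (is!r) $ q * matrix_inv (diag_mat w) $ q $ p * \<gamma> (is[r := p]))
      = v (is!r) / w (is!r) * \<gamma> is" for r
    unfolding matrix_inv_diag_mat[OF assms] diag_mat_nth
    by (simp add: mult_delta_left mult_delta_right divide_inverse)
  then show ?thesis
    by (simp add: diamond_def sum_distrib_right)
qed

text \<open>
  A diagonal endomorphism scales each decomposable form by the sum of its eigenvalues on the factors.
\<close>

lemma diamond_diag_mat_e3:
  assumes "\<And>i. w i \<noteq> 0"
  shows "diamond (diag_mat w) (diag_mat v) (e [i,j,k]) [l,m,n] =
     (v i / w i + v j / w j + v k / w k) * e [i,j,k] [l,m,n]"
proof -
  have "(\<Sum>r<length [l,m,n]. v ([l,m,n] ! r) / w ([l,m,n] ! r)) = v l / w l + v m / w m + v n / w n"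
    by (simp add: numeral_3_eq_3 lessThan_Suc)
  then show ?thesis
    by (simp only: diamond_diag_mat[OF assms] e3_diagonal_derivation[of "\<lambda>i. v i / w i"])
qed

lemma hodge_add: "hodge g k (\<lambda>js. \<alpha> js + \<beta> js) is = hodge g k \<alpha> is + hodge g k \<beta> is"
  unfolding hodge_def by (simp add: distrib_left distrib_right sum.distrib add_divide_distrib)

lemma hodge_scale: "hodge g k (\<lambda>js. r * \<alpha> js) is = r * hodge g k \<alpha> is"
  unfolding hodge_def by (simp add: sum_distrib_left ac_simps)

lemma hodge_diff: "hodge g k (\<lambda>js. \<alpha> js - \<beta> js) is = hodge g k \<alpha> is - hodge g k \<beta> is"
  using hodge_add[of g k \<alpha> "\<lambda>js. -1 * \<beta> js" "is"] unfolding hodge_scale by simp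

lemma hodge_3_diag_mat:
  assumes "\<And>i. w i \<noteq> 0"
  shows "hodge (diag_mat w) 3 (e [i,j,k]) is =
     1 / (w i * w j * w k) * vol_form (diag_mat w) (i # j # k # is)"
proof -
  \<comment> \<open>The inverse metric is diagonal, which collapses the inner sum; the outer one then runs over the six
    orders of \<open>i, j, k\<close>, and these contribute equally.\<close>
  let ?vol = "\<lambda>l m n. vol_form (diag_mat w) (l # m # n # is)"
  have inner: "(\<Sum>ls | length ls = 3. (\<Prod>r<3. matrix_inv (diag_mat w) $ ([l,m,n]!r) $ (ls!r)) * e [i,j,k] ls * v)
     = 1 / (w l * w m * w n) * v * e [i,j,k] [l,m,n]" for l m n v
    unfolding matrix_inv_diag_mat[OF assms] sum_lists_3
    unfolding numeral_3_eq_3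
    by (simp add: lessThan_Suc mult.assoc sum_diag_mat flip: sum_distrib_left) (simp add: divide_inverse)
  have swap1: "?vol m l n = - ?vol l m n" for l m n
    unfolding vol_form_def using e_swap[of _ "[]" m l "n # is"] by simp
  have swap2: "?vol l n m = - ?vol l m n" for l m n
    unfolding vol_form_def using e_swap[of _ "[l]" n m "is"] by simp
  have "hodge (diag_mat w) 3 (e [i,j,k]) is =
     (\<Sum>l\<in>UNIV. \<Sum>m\<in>UNIV. \<Sum>n\<in>UNIV. 1 / (w l * w m * w n) * ?vol l m n * e [i,j,k] [l,m,n]) / fact 3"
    unfolding hodge_def sum_lists_3[where F = "\<lambda>js. sum (F' js) S" for F' S] inner by simp
  also have "\<dots> = 1 / (w i * w j * w k) * ?vol i j k"
    unfolding e3_contract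
    using swap1[of i j k] swap2[of i j k] swap1[of i k j] swap2[of k i j] swap1[of j k i] swap2[of j i k]
    by (simp add: fact_numeral ac_simps)
  finally show ?thesis .
qed

lemma struct_coeff_antisym: "struct_coeff x j i k = - struct_coeff x i j k"
  unfolding struct_coeff_eq by auto

lemma levi_civita_diag_mat:
  assumes "\<And>i. w i \<noteq> 0"
  shows "levi_civita (\<lambda>_. diag_mat w) x = (\<lambda>i j k.
     (w k * struct_coeff x i j k - w i * struct_coeff x j k i + w j * struct_coeff x k i j) / (2 * w k))"
    (is "_ = ?\<Gamma>")
proof -
  have contract: "(\<Sum>l\<in>UNIV. \<Gamma> i j l * diag_mat w $ l $ k) + (\<Sum>l\<in>UNIV. \<Gamma> i k l * diag_mat w $ j $ l)
      = \<Gamma> i j k * w k + \<Gamma> i k j * w j" for \<Gamma> :: "7 \<Rightarrow> 7 \<Rightarrow> 7 \<Rightarrow> real" and i j k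
    unfolding diag_mat_nth by (simp add: mult_delta_right)
  show ?thesis
    unfolding levi_civita_def frame_deriv_const contract
  proof (rule the_equality, intro conjI allI)
    fix i j k
    show "?\<Gamma> i j k - ?\<Gamma> j i k = struct_coeff x i j k"
      using assms struct_coeff_antisym[of x i j k] struct_coeff_antisym[of x k j i] struct_coeff_antisym[of x i k j]
      by (simp add: field_simps)
    show "0 = ?\<Gamma> i j k * w k + ?\<Gamma> i k j * w j"
      using assms struct_coeff_antisym[of x i j k] struct_coeff_antisym[of x k j i] struct_coeff_antisym[of x i k j]
      by (simp add: field_simps)
  next
    fix \<Gamma>
    assume \<Gamma>: "(\<forall>i j k. \<Gamma> i j k - \<Gamma> j i k = struct_coeff x i j k) \<and> (\<forall>i j k. 0 = \<Gamma> i j k * w k + \<Gamma> i k j * w j)"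
    have "\<Gamma> i j k = ?\<Gamma> i j k" for i j k
    proof -
      have tf: "w q * \<Gamma> m p q - w q * \<Gamma> p m q = w q * struct_coeff x m p q" for m p q
        using \<Gamma> by (metis right_diff_distrib)
      have mt: "w q * \<Gamma> m p q + w p * \<Gamma> m q p = 0" for m p q
        using \<Gamma> by (metis mult.commute)
      \<comment> \<open>The Koszul formula: torsion-freeness and compatibility for the three cyclic permutations of \<open>i, j, k\<close>.\<close>
      have "2 * w k * \<Gamma> i j k = w k * struct_coeff x i j k - w i * struct_coeff x j k i + w j * struct_coeff x k i j"
        using tf[where m = i and p = j and q = k] tf[where m = j and p = k and q = i] tf[where m = k and p = i and q = j]
          mt[where m = i and p = j and q = k] mt[where m = j and p = k and q = i] mt[where m = k and p = i and q = j]
        by linarith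
      then show ?thesis using assms by (simp add: field_simps)
    qed
    then show "\<Gamma> = ?\<Gamma>" by blast
  qed
qed

lemma cov_deriv_invariant_add:
  "cov_deriv g (\<lambda>_ js. \<alpha> js + \<beta> js) x m is = cov_deriv g (\<lambda>_. \<alpha>) x m is + cov_deriv g (\<lambda>_. \<beta>) x m is"
  unfolding cov_deriv_def frame_deriv_const by (simp add: distrib_left sum.distrib)

lemma cov_deriv_invariant_scale:
  "cov_deriv g (\<lambda>_ js. r * \<alpha> js) x m is = r * cov_deriv g (\<lambda>_. \<alpha>) x m is"
  unfolding cov_deriv_def frame_deriv_const by (simp add: sum_distrib_left ac_simps)

lemma cov_deriv_invariant_diff:
  "cov_deriv g (\<lambda>_ js. \<alpha> js - \<beta> js) x m is = cov_deriv g (\<lambda>_. \<alpha>) x m is - cov_deriv g (\<lambda>_. \<beta>) x m is"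
  using cov_deriv_invariant_add[of g \<alpha> "\<lambda>js. -1 * \<beta> js" x m "is"] unfolding cov_deriv_invariant_scale by simp

lemma cov_deriv_e3:
  fixes g x
  defines "\<Gamma> \<equiv> levi_civita g x"
  shows "cov_deriv g (\<lambda>_. e [i,j,k]) x m [p,q,r] =
     - ((\<Sum>s\<in>UNIV. \<Gamma> m s i * e [s,j,k] [p,q,r]) + (\<Sum>s\<in>UNIV. \<Gamma> m s j * e [i,s,k] [p,q,r])
        + (\<Sum>s\<in>UNIV. \<Gamma> m s k * e [i,j,s] [p,q,r]))"
  unfolding e3_derivation[where A = "\<Gamma> m", symmetric]
  by (simp add: cov_deriv_def frame_deriv_const \<Gamma>_def numeral_3_eq_3 lessThan_Suc)

section \<open>The metric and the dual 4-form of the diagonal ansatz\<close>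

locale diagonal_G2 =
  fixes f a b c :: real
  assumes pos: "f > 0" "a > 0" "b > 0" "c > 0"
begin

definition phi :: tensor where
  "phi = (\<lambda>is. f * (a^2 * e [1,2,7] is + b^2 * e [3,4,7] is + c^2 * e [5,6,7] is)
      + a * b * c * (e [1,3,5] is - e [1,4,6] is - e [2,3,6] is - e [2,4,5] is))"

text \<open>
  The diagonal entries of the metric; the last case is the index 7.
\<close>

definition w :: "7 \<Rightarrow> real" where
  "w i = (if i = 1 \<or> i = 2 then a^2 else if i = 3 \<or> i = 4 then b^2
     else if i = 5 \<or> i = 6 then c^2 else f^2)"

lemma w_simps: "w 1 = a^2" "w 2 = a^2" "w 3 = b^2" "w 4 = b^2" "w 5 = c^2" "w 6 = c^2" "w 7 = f^2"
  by (simp_all add: w_def)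

lemma w_pos: "w i > 0"
  using pos by (simp add: w_def)

lemma w_nonzero: "w i \<noteq> 0"
  using w_pos[of i] by simp

lemma nonzero: "f \<noteq> 0" "a \<noteq> 0" "b \<noteq> 0" "c \<noteq> 0"
  using pos by auto

lemma vol_w: "vol_form (diag_mat w) is = f * a^2 * b^2 * c^2 * e [1,2,3,4,5,6,7] is"
proof -
  have "prod w UNIV = (f * a^2 * b^2 * c^2)^2"
    unfolding UNIV_7 by (simp add: w_simps power_mult_distrib)
  moreover have "f * a^2 * b^2 * c^2 \<ge> 0" using pos by simp
  ultimately show ?thesis by (simp add: vol_form_def det_diag_mat)
qed

lemma e_top: "e [1,2,3,4,5,6,7] [1,2,3,4,5,6,7] = 1"
  by (simp add: e_interior)

text \<open>
  Only the seven triples in the support of \<open>\<phi>\<close> contribute, and each leaves the complementary four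
  arguments to \<open>\<beta>\<close>.
\<close>

lemma wedge_4_phi:
  "wedge 4 \<beta> phi [1,2,3,4,5,6,7] =
     f * (a^2 * \<beta> [3,4,5,6] + b^2 * \<beta> [1,2,5,6] + c^2 * \<beta> [1,2,3,4])
     + a * b * c * (- \<beta> [2,4,6,7] + \<beta> [2,3,5,7] + \<beta> [1,4,5,7] + \<beta> [1,3,6,7])"
proof -
  have four: "(4::nat) = Suc (Suc (Suc (Suc 0)))" by simp
  show ?thesis
    unfolding four
    by (simp add: wedge_Suc_Cons wedge_0 wedge_Suc_Nil phi_def e_interior) (simp add: algebra_simps)
qed

lemma wedge_2_2: "wedge 2 \<alpha> \<beta> [i,j,k,l] =
    \<alpha> [i,j] * \<beta> [k,l] - \<alpha> [i,k] * \<beta> [j,l] + \<alpha> [i,l] * \<beta> [j,k]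
  + \<alpha> [j,k] * \<beta> [i,l] - \<alpha> [j,l] * \<beta> [i,k] + \<alpha> [k,l] * \<beta> [i,j]"
  unfolding numeral_2_eq_2
  by (simp add: wedge_Suc_Cons wedge_0 wedge_Suc_Nil)

text \<open>
  Any two indices lie in exactly one of the seven triples in the support of \<open>\<phi>\<close>, which form a Fano plane,
  so each component has a single term. This is why the metric comes out diagonal.
\<close>

lemma interior_phi:
  "interior X phi [1,2] = f * a^2 * X$7" "interior X phi [3,4] = f * b^2 * X$7"
  "interior X phi [5,6] = f * c^2 * X$7"
  "interior X phi [1,3] = a * b * c * X$5" "interior X phi [1,4] = - (a * b * c * X$6)"
  "interior X phi [1,5] = - (a * b * c * X$3)" "interior X phi [1,6] = a * b * c * X$4"
  "interior X phi [1,7] = - (f * a^2 * X$2)" "interior X phi [2,7] = f * a^2 * X$1"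
  "interior X phi [2,3] = - (a * b * c * X$6)" "interior X phi [2,4] = - (a * b * c * X$5)"
  "interior X phi [2,5] = a * b * c * X$4" "interior X phi [2,6] = a * b * c * X$3"
  "interior X phi [3,5] = a * b * c * X$1" "interior X phi [3,6] = - (a * b * c * X$2)"
  "interior X phi [3,7] = - (f * b^2 * X$4)" "interior X phi [4,7] = f * b^2 * X$3"
  "interior X phi [4,5] = - (a * b * c * X$2)" "interior X phi [4,6] = - (a * b * c * X$1)"
  "interior X phi [5,7] = - (f * c^2 * X$6)" "interior X phi [6,7] = f * c^2 * X$5"
  by (simp_all add: interior_def phi_def sum_7 e_interior)

lemma wedge_phi: "wedge 4 (wedge 2 (interior X phi) (interior Y phi)) phi [1,2,3,4,5,6,7]
    = 6 * (f * a^2 * b^2 * c^2) * (X \<bullet> (diag_mat w *v Y))"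
  unfolding wedge_4_phi wedge_2_2 matrix_form_diag_mat interior_phi sum_7 w_simps
  by (simp add: algebra_simps power2_eq_square)

lemma is_G2_metric_w: "is_G2_metric phi (diag_mat w)"
  unfolding is_G2_metric_def
proof (intro conjI allI impI)
  show "transpose (diag_mat w) = diag_mat w"
    by (simp add: transpose_def diag_mat_def vec_eq_iff)
  fix v :: "real^7" assume "v \<noteq> 0"
  then obtain i where "v $ i \<noteq> 0" by (auto simp: vec_eq_iff)
  then have "0 < w i * v $ i * v $ i" using w_pos[of i] by (auto simp add: mult.assoc zero_less_mult_iff linorder_neq_iff)
  also have "\<dots> \<le> v \<bullet> (diag_mat w *v v)"
    unfolding matrix_form_diag_mat
    by (rule member_le_sum) (auto simp: mult.assoc less_imp_le[OF w_pos])
  finally show "v \<bullet> (diag_mat w *v v) > 0" .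
qed (simp only: wedge_phi vol_w e_top, simp)

lemma G2_metric_phi: "G2_metric phi = diag_mat w"
  unfolding G2_metric_def
proof (rule the_equality[where P = "is_G2_metric phi", OF is_G2_metric_w])
  fix g assume g: "is_G2_metric phi g"
  \<comment> \<open>The density \<open>g \<otimes> vol\<^sub>g\<close> is prescribed by the 3-form, so two solutions are proportional: \<open>g = r \<cdot> diag_mat w\<close>.\<close>
  define v where "v = f * a^2 * b^2 * c^2"
  have v: "v > 0" using pos by (simp add: v_def)
  have inner_axis: "axis i 1 \<bullet> (h *v axis j 1) = h $ i $ j" for h :: "real^7^7" and i j
    by (simp add: inner_axis' matrix_vector_mult_basis column_def)
  have "6 * v * (axis i 1 \<bullet> (diag_mat w *v axis j 1)) = 6 * (axis i 1 \<bullet> (g *v axis j 1)) * sqrt (det g)" for i j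
    using g unfolding is_G2_metric_def wedge_phi vol_form_def e_top v_def by (metis mult_1_right)
  then have eq: "g $ i $ j * sqrt (det g) = v * diag_mat w $ i $ j" for i j
    unfolding inner_axis by (simp add: mult.commute)
  have gpos: "g $ i $ i > 0" for i
    using g inner_axis[of i g i] unfolding is_G2_metric_def
    by (metis axis_eq_0_iff zero_neq_one)
  \<comment> \<open>The function \<^const>\<open>sqrt\<close> is negative on negative arguments, so the sign of \<open>det g\<close> has to be read off
    from a diagonal entry.\<close>
  have "g $ 1 $ 1 * sqrt (det g) > 0"
    using v w_pos[of 1] unfolding eq diag_mat_nth by simp
  then have det: "sqrt (det g) > 0" using gpos[of 1] by (simp add: zero_less_mult_iff)
  define r where "r = v / sqrt (det g)"
  have r: "r > 0" using v det by (simp add: r_def)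
  have gij: "g $ i $ j = r * diag_mat w $ i $ j" for i j
    using eq[of i j] det by (simp add: r_def field_simps)
  then have g_eq: "g = diag_mat (\<lambda>i. r * w i)"
    by (simp add: vec_eq_iff diag_mat_nth)
  \<comment> \<open>Rescaling by \<open>r\<close> multiplies the determinant by \<open>r\<^sup>7\<close>, while the density only allows \<open>1/r\<^sup>2\<close>.\<close>
  have "det g = r^7 * v^2"
    unfolding g_eq det_diag_mat UNIV_7 v_def by (simp add: w_simps) (simp add: algebra_simps power_def)
  moreover have "det g = (v / r)^2"
    using det v by (simp add: r_def)
  ultimately have "r^9 = 1"
    using v r by (simp add: field_simps flip: power_add)
  then have "r = 1" using r by (metis power_eq_1_iff zero_neq_numeral abs_of_pos real_norm_def)
  then show "g = diag_mat w" unfolding g_eq by simp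
qed

lemma alternating_phi: "alternating 3 phi"
  using e3_alternating unfolding alternating_def phi_def by (simp add: algebra_simps)

lemma smooth_fun_const: "smooth_fun (\<lambda>_. r)"
proof -
  have "\<exists>r. u = (\<lambda>_. r) \<Longrightarrow> smooth_fun u" for u
    by (coinduction arbitrary: u) auto
  then show ?thesis by blast
qed

lemma G2_structure_phi: "G2_structure (\<lambda>_. phi)"
  unfolding G2_structure_def using smooth_fun_const alternating_phi is_G2_metric_w by blast

lemma psi_phi:
  "G2_psi phi is = a^2 * b^2 * e [1,2,3,4] is + a^2 * c^2 * e [1,2,5,6] is + b^2 * c^2 * e [3,4,5,6] is
     + f * (a * b * c) * (e [2,3,5,7] is + e [1,4,5,7] is + e [1,3,6,7] is - e [2,4,6,7] is)"
  unfolding G2_psi_def G2_metric_phi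
  unfolding phi_def hodge_add hodge_diff hodge_scale hodge_3_diag_mat[OF w_nonzero] vol_w
  using nonzero by (simp add: w_simps e_interior power2_eq_square) (simp add: algebra_simps)

lemma psi_interior:
  "G2_psi phi (1 # is) = a^2 * b^2 * e [2,3,4] is + a^2 * c^2 * e [2,5,6] is + f * (a*b*c) * (e [4,5,7] is + e [3,6,7] is)"
  "G2_psi phi (2 # is) = - (a^2 * b^2 * e [1,3,4] is) - a^2 * c^2 * e [1,5,6] is + f * (a*b*c) * (e [3,5,7] is - e [4,6,7] is)"
  "G2_psi phi (3 # is) = a^2 * b^2 * e [1,2,4] is + b^2 * c^2 * e [4,5,6] is - f * (a*b*c) * (e [2,5,7] is + e [1,6,7] is)"
  "G2_psi phi (4 # is) = - (a^2 * b^2 * e [1,2,3] is) - b^2 * c^2 * e [3,5,6] is - f * (a*b*c) * (e [1,5,7] is - e [2,6,7] is)"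
  "G2_psi phi (5 # is) = a^2 * c^2 * e [1,2,6] is + b^2 * c^2 * e [3,4,6] is + f * (a*b*c) * (e [2,3,7] is + e [1,4,7] is)"
  "G2_psi phi (6 # is) = - (a^2 * c^2 * e [1,2,5] is) - b^2 * c^2 * e [3,4,5] is + f * (a*b*c) * (e [1,3,7] is - e [2,4,7] is)"
  "G2_psi phi (7 # is) = f * (a*b*c) * (e [2,4,6] is - e [2,3,5] is - e [1,4,5] is - e [1,3,6] is)"
  unfolding psi_phi by (simp_all add: e_interior) (simp_all add: algebra_simps)

section \<open>Connection and torsion\<close>

lemma connection_table:
  fixes x :: heis
  defines "\<Gamma> \<equiv> levi_civita (\<lambda>_. diag_mat w) x"
  shows
  "\<Gamma> 1 q k = (if q = 2 \<and> k = 7 then - 1/2 else if q = 7 \<and> k = 2 then f^2 / (2 * a^2) else 0)"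
  "\<Gamma> 2 q k = (if q = 1 \<and> k = 7 then 1/2 else if q = 7 \<and> k = 1 then - (f^2 / (2 * a^2)) else 0)"
  "\<Gamma> 3 q k = (if q = 4 \<and> k = 7 then - 1/2 else if q = 7 \<and> k = 4 then f^2 / (2 * b^2) else 0)"
  "\<Gamma> 4 q k = (if q = 3 \<and> k = 7 then 1/2 else if q = 7 \<and> k = 3 then - (f^2 / (2 * b^2)) else 0)"
  "\<Gamma> 5 q k = (if q = 6 \<and> k = 7 then - 1/2 else if q = 7 \<and> k = 6 then f^2 / (2 * c^2) else 0)"
  "\<Gamma> 6 q k = (if q = 5 \<and> k = 7 then 1/2 else if q = 7 \<and> k = 5 then - (f^2 / (2 * c^2)) else 0)"
  "\<Gamma> 7 q k = (if q = 1 \<and> k = 2 then f^2 / (2 * a^2) else if q = 2 \<and> k = 1 then - (f^2 / (2 * a^2))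
     else if q = 3 \<and> k = 4 then f^2 / (2 * b^2) else if q = 4 \<and> k = 3 then - (f^2 / (2 * b^2))
     else if q = 5 \<and> k = 6 then f^2 / (2 * c^2) else if q = 6 \<and> k = 5 then - (f^2 / (2 * c^2)) else 0)"
proof -
  have all: "\<Gamma> m q k = (w k * struct_coeff x m q k - w m * struct_coeff x q k m + w q * struct_coeff x k m q) / (2 * w k)"
    for m q k unfolding \<Gamma>_def levi_civita_diag_mat[OF w_nonzero] ..
  note simps = all struct_coeff_eq w_simps
  show
  "\<Gamma> 1 q k = (if q = 2 \<and> k = 7 then - 1/2 else if q = 7 \<and> k = 2 then f^2 / (2 * a^2) else 0)"
    using nonzero by (auto simp: simps)
  show
  "\<Gamma> 2 q k = (if q = 1 \<and> k = 7 then 1/2 else if q = 7 \<and> k = 1 then - (f^2 / (2 * a^2)) else 0)"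
    using nonzero by (auto simp: simps)
  show
  "\<Gamma> 3 q k = (if q = 4 \<and> k = 7 then - 1/2 else if q = 7 \<and> k = 4 then f^2 / (2 * b^2) else 0)"
    using nonzero by (auto simp: simps)
  show
  "\<Gamma> 4 q k = (if q = 3 \<and> k = 7 then 1/2 else if q = 7 \<and> k = 3 then - (f^2 / (2 * b^2)) else 0)"
    using nonzero by (auto simp: simps)
  show
  "\<Gamma> 5 q k = (if q = 6 \<and> k = 7 then - 1/2 else if q = 7 \<and> k = 6 then f^2 / (2 * c^2) else 0)"
    using nonzero by (auto simp: simps)
  show
  "\<Gamma> 6 q k = (if q = 5 \<and> k = 7 then 1/2 else if q = 7 \<and> k = 5 then - (f^2 / (2 * c^2)) else 0)"
    using nonzero by (auto simp: simps)
  show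
  "\<Gamma> 7 q k = (if q = 1 \<and> k = 2 then f^2 / (2 * a^2) else if q = 2 \<and> k = 1 then - (f^2 / (2 * a^2))
     else if q = 3 \<and> k = 4 then f^2 / (2 * b^2) else if q = 4 \<and> k = 3 then - (f^2 / (2 * b^2))
     else if q = 5 \<and> k = 6 then f^2 / (2 * c^2) else if q = 6 \<and> k = 5 then - (f^2 / (2 * c^2)) else 0)"
    using nonzero by (auto simp: simps)
qed

text \<open>
  The entries of the torsion tensor, which is diagonal in the frame.
\<close>

definition tau :: "7 \<Rightarrow> real" where
  "tau i = (if i = 7 then - (f^3 / 2 * (1 / a^2 + 1 / b^2 + 1 / c^2)) else f / 2)"

lemma tau_simps: "tau 1 = f / 2" "tau 2 = f / 2" "tau 3 = f / 2" "tau 4 = f / 2" "tau 5 = f / 2" "tau 6 = f / 2"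
   "tau 7 = - (f^3 / 2 * (1 / a^2 + 1 / b^2 + 1 / c^2))"
  by (simp_all add: tau_def)

text \<open>
  The derivation \<open>\<nabla>\<^sub>m\<close> replaces one covector in each term of \<open>\<phi>\<close> according to the connection table. For
  \<open>m \<le> 6\<close>, with \<open>n\<close> the partner of \<open>m\<close> in its pair, it only mixes \<open>e\<^sup>n\<close> and \<open>e\<^sup>7\<close>; for \<open>m = 7\<close> it rotates the
  three planes of the pairs, and \<open>e\<^sup>1\<^sup>3\<^sup>5 - e\<^sup>1\<^sup>4\<^sup>6 - e\<^sup>2\<^sup>3\<^sup>6 - e\<^sup>2\<^sup>4\<^sup>5\<close>, the real part of the complex volume form
  \<open>(e\<^sup>1 + \<i> e\<^sup>2) \<and> (e\<^sup>3 + \<i> e\<^sup>4) \<and> (e\<^sup>5 + \<i> e\<^sup>6)\<close>, goes to its imaginary part times the sum of the angular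
  velocities, up to sign. In either case the result is a multiple of \<open>e\<^sub>m \<lrcorner> \<psi>\<close>.
\<close>

lemma cov_deriv_phi:
  "cov_deriv (\<lambda>_. diag_mat w) (\<lambda>_. phi) x m [i,j,k] = tau m / w m * G2_psi phi [m,i,j,k]"
proof -
  have "\<forall>m. cov_deriv (\<lambda>_. diag_mat w) (\<lambda>_. phi) x m [i,j,k] = tau m / w m * G2_psi phi [m,i,j,k]"
    unfolding forall_7 psi_interior tau_simps w_simps
    unfolding phi_def cov_deriv_invariant_add cov_deriv_invariant_diff cov_deriv_invariant_scale cov_deriv_e3
      connection_table sum_7
    using nonzero
    by (simp add: e3_sort rank7_simps) (simp add: field_simps power2_eq_square power3_eq_cube)
  then show ?thesis by blast
qed

text \<open>
  Two of the seven quadruples in the support of \<open>\<psi>\<close> share two indices, so a triple completes to at most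
  one of them. Evaluating on a triple that is completed by \<open>q\<close> isolates the \<open>q\<close>-th column of the torsion.
\<close>

lemma psi_isolates:
  "\<exists>i j k. G2_psi phi [q,i,j,k] \<noteq> 0 \<and> (\<forall>p. p \<noteq> q \<longrightarrow> G2_psi phi [p,i,j,k] = 0)"
proof -
  have "\<forall>q. \<exists>i j k. G2_psi phi [q,i,j,k] \<noteq> 0 \<and> (\<forall>p. p \<noteq> q \<longrightarrow> G2_psi phi [p,i,j,k] = 0)"
    unfolding forall_7
    using nonzero
    apply (intro conjI)
    subgoal by (rule exI[of _ 2], rule exI[of _ 3], rule exI[of _ 4], simp add: psi_interior e_interior)
    subgoal by (rule exI[of _ 1], rule exI[of _ 3], rule exI[of _ 4], simp add: psi_interior e_interior)
    subgoal by (rule exI[of _ 1], rule exI[of _ 2], rule exI[of _ 4], simp add: psi_interior e_interior)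
    subgoal by (rule exI[of _ 1], rule exI[of _ 2], rule exI[of _ 3], simp add: psi_interior e_interior)
    subgoal by (rule exI[of _ 1], rule exI[of _ 2], rule exI[of _ 6], simp add: psi_interior e_interior)
    subgoal by (rule exI[of _ 1], rule exI[of _ 2], rule exI[of _ 5], simp add: psi_interior e_interior)
    subgoal by (rule exI[of _ 2], rule exI[of _ 4], rule exI[of _ 6], simp add: psi_interior e_interior)
    done
  then show ?thesis by blast
qed

lemma torsion_phi: "G2_torsion (\<lambda>_. phi) x = diag_mat tau"
  unfolding G2_torsion_def G2_metric_phi matrix_inv_diag_mat[OF w_nonzero] cov_deriv_phi
proof (rule the_equality)
  show "\<forall>m i j k. tau m / w m * G2_psi phi [m,i,j,k] =
     (\<Sum>p\<in>UNIV. \<Sum>q\<in>UNIV. diag_mat tau $ m $ q * diag_mat (\<lambda>i. inverse (w i)) $ q $ p * G2_psi phi [p,i,j,k])"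
    by (simp add: mult.assoc sum_diag_mat divide_inverse flip: sum_distrib_left)
  fix T :: "real^7^7"
  have contract: "(\<Sum>p\<in>UNIV. \<Sum>q\<in>UNIV. T $ m $ q * diag_mat (\<lambda>i. inverse (w i)) $ q $ p * F p) =
      (\<Sum>p\<in>UNIV. T $ m $ p / w p * F p)" for m F
    by (subst sum.swap) (simp add: mult.assoc sum_diag_mat divide_inverse flip: sum_distrib_left)
  assume "\<forall>m i j k. tau m / w m * G2_psi phi [m,i,j,k] =
     (\<Sum>p\<in>UNIV. \<Sum>q\<in>UNIV. T $ m $ q * diag_mat (\<lambda>i. inverse (w i)) $ q $ p * G2_psi phi [p,i,j,k])"
  then have T: "tau m / w m * G2_psi phi [m,i,j,k] = (\<Sum>p\<in>UNIV. T $ m $ p / w p * G2_psi phi [p,i,j,k])"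
    for m i j k unfolding contract by blast
  have "T $ m $ q = diag_mat tau $ m $ q" for m q
  proof -
    obtain i j k where nz: "G2_psi phi [q,i,j,k] \<noteq> 0" and z: "\<And>p. p \<noteq> q \<Longrightarrow> G2_psi phi [p,i,j,k] = 0"
      using psi_isolates by blast
    have "(\<Sum>p\<in>UNIV. T $ m $ p / w p * G2_psi phi [p,i,j,k])
        = (\<Sum>p\<in>UNIV. if p = q then T $ m $ q / w q * G2_psi phi [q,i,j,k] else 0)"
      by (rule sum.cong) (auto simp: z)
    then have "tau m / w m * G2_psi phi [m,i,j,k] = T $ m $ q / w q * G2_psi phi [q,i,j,k]"
      using T[of m i j k] by simp
    then show ?thesis
      using nz z[of m] w_nonzero[of q] by (cases "m = q") (auto simp: diag_mat_nth)
  qed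
  then show "T = diag_mat tau" by (simp add: vec_eq_iff)
qed

definition torsion_norm2 :: real where
  "torsion_norm2 = f^2 / 2 * (1 / a^4 + 1 / b^4 + 1 / c^4) + f^2 / 4 * (1 / a^2 + 1 / b^2 + 1 / c^2)^2"

lemma tensor_norm2_phi: "tensor_norm2 (diag_mat w) (diag_mat tau) = torsion_norm2"
proof -
  have "tensor_norm2 (diag_mat w) (diag_mat tau) = (\<Sum>i\<in>UNIV. (tau i / w i)^2)"
    unfolding tensor_norm2_def matrix_inv_diag_mat[OF w_nonzero]
    by (simp add: mult.assoc sum_diag_mat flip: sum_distrib_left)
      (simp add: diag_mat_nth power2_eq_square divide_inverse ac_simps)
  also have "\<dots> = torsion_norm2"
    unfolding sum_7 tau_simps w_simps torsion_norm2_def using nonzero by (simp add: field_simps power2_eq_square power4_eq_xxxx power3_eq_cube)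
  finally show ?thesis .
qed

lemma tensor_TtT_phi: "tensor_TtT (diag_mat w) (diag_mat tau) = diag_mat (\<lambda>i. (tau i)^2 / w i)"
  unfolding tensor_TtT_def matrix_inv_diag_mat[OF w_nonzero]
  by (simp add: vec_eq_iff mult.assoc sum_diag_mat flip: sum_distrib_left)
    (simp add: diag_mat_nth mult_delta_left mult_delta_right power2_eq_square divide_inverse)

lemma divergence_phi: "divergence (\<lambda>_. diag_mat w) (\<lambda>_. diag_mat tau) x = 0"
proof -
  have \<Gamma>: "\<forall>j i. levi_civita (\<lambda>_. diag_mat w) x j j i = 0 \<and> levi_civita (\<lambda>_. diag_mat w) x j i j = 0"
    unfolding forall_7 connection_table by simp
  have "cov_deriv (\<lambda>_. diag_mat w) (\<lambda>_. mat_tensor (diag_mat tau)) x j [j, i] = 0" for i j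
    using \<Gamma> by (simp add: cov_deriv_def frame_deriv_const numeral_2_eq_2 lessThan_Suc mat_tensor_def diag_mat_nth mult_delta_right)
  then show ?thesis
    unfolding divergence_def matrix_inv_diag_mat[OF w_nonzero] diag_mat_nth
    by (simp add: vec_eq_iff mult_delta_left)
qed

section \<open>Curvature and the right-hand side of the flow\<close>

text \<open>
  The entries of the Ricci tensor, which is diagonal in the frame.
\<close>

definition rho :: "7 \<Rightarrow> real" where
  "rho i = (if i = 7 then f^4 / 2 * (1 / a^4 + 1 / b^4 + 1 / c^4) else - (f^2 / (2 * w i)))"

lemma rho_simps: "rho 1 = - (f^2 / (2 * a^2))" "rho 2 = - (f^2 / (2 * a^2))"
  "rho 3 = - (f^2 / (2 * b^2))" "rho 4 = - (f^2 / (2 * b^2))"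
  "rho 5 = - (f^2 / (2 * c^2))" "rho 6 = - (f^2 / (2 * c^2))"
  "rho 7 = f^4 / 2 * (1 / a^4 + 1 / b^4 + 1 / c^4)"
  by (simp_all add: rho_def w_simps)

lemma struct_coeff_simps:
  "struct_coeff x 1 j k = (if j = 2 \<and> k = 7 then -1 else 0)"
  "struct_coeff x 2 j k = (if j = 1 \<and> k = 7 then 1 else 0)"
  "struct_coeff x 3 j k = (if j = 4 \<and> k = 7 then -1 else 0)"
  "struct_coeff x 4 j k = (if j = 3 \<and> k = 7 then 1 else 0)"
  "struct_coeff x 5 j k = (if j = 6 \<and> k = 7 then -1 else 0)"
  "struct_coeff x 6 j k = (if j = 5 \<and> k = 7 then 1 else 0)"
  "struct_coeff x 7 j k = 0"
  unfolding struct_coeff_eq by auto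

lemma ricci_phi: "ricci (\<lambda>_. diag_mat w) x = diag_mat rho"
proof -
  have const: "frame_deriv i (\<lambda>y. levi_civita (\<lambda>_. diag_mat w) y j k l) x = 0" for i j k l
    unfolding levi_civita_diag_mat[OF w_nonzero] struct_coeff_eq by (rule frame_deriv_const)
  have "\<forall>j k. ricci (\<lambda>_. diag_mat w) x $ j $ k = diag_mat rho $ j $ k"
    unfolding forall_7 ricci_def riemann_def const sum_7
    by (simp add: connection_table struct_coeff_simps rho_simps diag_mat_nth) (simp add: field_simps power2_eq_square power4_eq_xxxx)
  then show ?thesis by (simp add: vec_eq_iff)
qed

lemma ricci_harmonic_rhs_phi:
  "ricci_harmonic_rhs (\<lambda>_. phi) x [i,j,k] =
     - (f^3 * (4 * a^4 * (b^4 + c^4) - b^4 * c^4) / (2 * a^2 * b^4 * c^4)) * e [1,2,7] [i,j,k]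
     + - (f^3 * (4 * b^4 * (a^4 + c^4) - a^4 * c^4) / (2 * a^4 * b^2 * c^4)) * e [3,4,7] [i,j,k]
     + - (f^3 * (4 * c^4 * (a^4 + b^4) - a^4 * b^4) / (2 * a^4 * b^4 * c^2)) * e [5,6,7] [i,j,k]
     + - (f^2 * (3 * (a * b * c)^2 * (a^2 + b^2 + c^2) + 2 * (a^4 * b^4 + a^4 * c^4 + b^4 * c^4))
            / (2 * a^3 * b^3 * c^3)) *
        (e [1,3,5] [i,j,k] - e [1,4,6] [i,j,k] - e [2,3,6] [i,j,k] - e [2,4,5] [i,j,k])"
proof -
  define v where "v i = - rho i + 3 * ((tau i)^2 / w i) - torsion_norm2 * w i" for i
  have "(\<lambda>x. G2_torsion (\<lambda>_. phi) x) = (\<lambda>_. diag_mat tau)" using torsion_phi by auto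
  then have torsion: "G2_torsion (\<lambda>_. phi) = (\<lambda>_. diag_mat tau)" by simp
  have "- diag_mat rho + 3 *\<^sub>R diag_mat (\<lambda>i. (tau i)^2 / w i) - torsion_norm2 *\<^sub>R diag_mat w = diag_mat v"
    by (simp add: vec_eq_iff diag_mat_nth v_def)
  then have "ricci_harmonic_rhs (\<lambda>_. phi) x [i,j,k] = diamond (diag_mat w) (diag_mat v) phi [i,j,k]"
    unfolding ricci_harmonic_rhs_def Let_def G2_metric_phi torsion divergence_phi ricci_phi tensor_norm2_phi
      tensor_TtT_phi
    by (simp add: interior_def)
  also have "\<dots> =
      f * (a^2 * ((v 1 / w 1 + v 2 / w 2 + v 7 / w 7) * e [1,2,7] [i,j,k])
        + b^2 * ((v 3 / w 3 + v 4 / w 4 + v 7 / w 7) * e [3,4,7] [i,j,k])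
        + c^2 * ((v 5 / w 5 + v 6 / w 6 + v 7 / w 7) * e [5,6,7] [i,j,k]))
    + a * b * c * ((v 1 / w 1 + v 3 / w 3 + v 5 / w 5) * e [1,3,5] [i,j,k]
        - (v 1 / w 1 + v 4 / w 4 + v 6 / w 6) * e [1,4,6] [i,j,k]
        - (v 2 / w 2 + v 3 / w 3 + v 6 / w 6) * e [2,3,6] [i,j,k]
        - (v 2 / w 2 + v 4 / w 4 + v 5 / w 5) * e [2,4,5] [i,j,k])"
    unfolding phi_def diamond_add diamond_diff diamond_scale diamond_diag_mat_e3[OF w_nonzero] ..
  finally have rhs: "ricci_harmonic_rhs (\<lambda>_. phi) x [i,j,k] = \<dots>" .
  \<comment> \<open>In terms of \<open>p, q, r\<close> every \<open>v i / w i\<close> is \<open>f\<^sup>2\<close> times a quadratic polynomial.\<close>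
  define p q r where pqr: "p = 1 / a^2" "q = 1 / b^2" "r = 1 / c^2"
  define N where "N = f^2 / 2 * (p^2 + q^2 + r^2) + f^2 / 4 * (p + q + r)^2"
  have N: "torsion_norm2 = N"
    unfolding torsion_norm2_def N_def pqr by (simp add: power_divide)
  have v: "v i / w i = - (rho i / w i) + 3 * (tau i / w i)^2 - N" for i
    using w_nonzero[of i] unfolding v_def N by (simp add: field_simps power2_eq_square)
  have rho: "rho 1 / w 1 = - (f^2 / 2 * p^2)" "rho 2 / w 2 = - (f^2 / 2 * p^2)"
    "rho 3 / w 3 = - (f^2 / 2 * q^2)" "rho 4 / w 4 = - (f^2 / 2 * q^2)"
    "rho 5 / w 5 = - (f^2 / 2 * r^2)" "rho 6 / w 6 = - (f^2 / 2 * r^2)"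
    "rho 7 / w 7 = f^2 / 2 * (p^2 + q^2 + r^2)"
    unfolding rho_simps w_simps pqr using nonzero
    by (simp_all add: power_divide) (simp_all add: power2_eq_square power4_eq_xxxx)
  have tau: "tau 1 / w 1 = f / 2 * p" "tau 2 / w 2 = f / 2 * p"
    "tau 3 / w 3 = f / 2 * q" "tau 4 / w 4 = f / 2 * q"
    "tau 5 / w 5 = f / 2 * r" "tau 6 / w 6 = f / 2 * r"
    "tau 7 / w 7 = - (f / 2 * (p + q + r))"
    unfolding tau_simps w_simps pqr using nonzero
    by (simp_all add: power2_eq_square power3_eq_cube)
  have S: "v 1 / w 1 + v 2 / w 2 + v 7 / w 7 = f^2 * (p^2 / 2 - 2 * (q^2 + r^2))"
    "v 3 / w 3 + v 4 / w 4 + v 7 / w 7 = f^2 * (q^2 / 2 - 2 * (p^2 + r^2))"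
    "v 5 / w 5 + v 6 / w 6 + v 7 / w 7 = f^2 * (r^2 / 2 - 2 * (p^2 + q^2))"
    "v 1 / w 1 + v 3 / w 3 + v 5 / w 5 = - (f^2 * (p^2 + q^2 + r^2 + 3 / 2 * (p * q + p * r + q * r)))"
    "v 1 / w 1 + v 4 / w 4 + v 6 / w 6 = - (f^2 * (p^2 + q^2 + r^2 + 3 / 2 * (p * q + p * r + q * r)))"
    "v 2 / w 2 + v 3 / w 3 + v 6 / w 6 = - (f^2 * (p^2 + q^2 + r^2 + 3 / 2 * (p * q + p * r + q * r)))"
    "v 2 / w 2 + v 4 / w 4 + v 5 / w 5 = - (f^2 * (p^2 + q^2 + r^2 + 3 / 2 * (p * q + p * r + q * r)))"
    unfolding v rho tau N_def by (simp_all add: field_simps power2_eq_square)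
  have C: "f^3 * (4 * a^4 * (b^4 + c^4) - b^4 * c^4) / (2 * a^2 * b^4 * c^4)
      = - (f * a^2 * (f^2 * (p^2 / 2 - 2 * (q^2 + r^2))))"
    "f^3 * (4 * b^4 * (a^4 + c^4) - a^4 * c^4) / (2 * a^4 * b^2 * c^4)
      = - (f * b^2 * (f^2 * (q^2 / 2 - 2 * (p^2 + r^2))))"
    "f^3 * (4 * c^4 * (a^4 + b^4) - a^4 * b^4) / (2 * a^4 * b^4 * c^2)
      = - (f * c^2 * (f^2 * (r^2 / 2 - 2 * (p^2 + q^2))))"
    "f^2 * (3 * (a * b * c)^2 * (a^2 + b^2 + c^2) + 2 * (a^4 * b^4 + a^4 * c^4 + b^4 * c^4)) / (2 * a^3 * b^3 * c^3)
      = a * b * c * (f^2 * (p^2 + q^2 + r^2 + 3 / 2 * (p * q + p * r + q * r)))"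
    unfolding pqr using nonzero by (simp_all add: field_simps power2_eq_square power3_eq_cube power4_eq_xxxx)
  show ?thesis
    unfolding rhs S C by (simp add: algebra_simps)
qed

end

section \<open>The differential equations\<close>

text \<open>
  The forms \<open>e\<^sup>1\<^sup>2\<^sup>7\<close>, \<open>e\<^sup>3\<^sup>4\<^sup>7\<close>, \<open>e\<^sup>5\<^sup>6\<^sup>7\<close> and \<open>e\<^sup>1\<^sup>3\<^sup>5 - e\<^sup>1\<^sup>4\<^sup>6 - e\<^sup>2\<^sup>3\<^sup>6 - e\<^sup>2\<^sup>4\<^sup>5\<close> have disjoint supports, so their
  coefficients can be read off on the frame vectors.
\<close>

lemma has_derivative_components:
  fixes F1 F2 F3 F4 :: "real \<Rightarrow> real"
  shows "(\<forall>i j k. ((\<lambda>s. F1 s * e [1,2,7] [i,j,k] + F2 s * e [3,4,7] [i,j,k] + F3 s * e [5,6,7] [i,j,k]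
        + F4 s * (e [1,3,5] [i,j,k] - e [1,4,6] [i,j,k] - e [2,3,6] [i,j,k] - e [2,4,5] [i,j,k]))
      has_real_derivative D1 * e [1,2,7] [i,j,k] + D2 * e [3,4,7] [i,j,k] + D3 * e [5,6,7] [i,j,k]
        + D4 * (e [1,3,5] [i,j,k] - e [1,4,6] [i,j,k] - e [2,3,6] [i,j,k] - e [2,4,5] [i,j,k])) (at t within S))
    \<longleftrightarrow> (F1 has_real_derivative D1) (at t within S) \<and> (F2 has_real_derivative D2) (at t within S)
      \<and> (F3 has_real_derivative D3) (at t within S) \<and> (F4 has_real_derivative D4) (at t within S)"
    (is "(\<forall>i j k. (?F i j k has_real_derivative ?D i j k) (at t within S)) \<longleftrightarrow> ?R")
proof
  assume "\<forall>i j k. (?F i j k has_real_derivative ?D i j k) (at t within S)"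
  then have "(?F i j k has_real_derivative ?D i j k) (at t within S)" for i j k by blast
  from this[of 1 2 7] this[of 3 4 7] this[of 5 6 7] this[of 1 3 5] show ?R
    by (simp add: e_interior)
next
  assume ?R
  then show "\<forall>i j k. (?F i j k has_real_derivative ?D i j k) (at t within S)"
    by (auto intro!: DERIV_add DERIV_cmult_right)
qed

theorem theorem4p5:
  fixes f a b c :: "real \<Rightarrow> real" and I :: "real set"
  assumes "is_interval I" and "0 \<in> I"
    and "smooth_on_interval I f" and "smooth_on_interval I a"
    and "smooth_on_interval I b" and "smooth_on_interval I c"
    and "\<And>t. t \<in> I \<Longrightarrow> f t > 0" and "\<And>t. t \<in> I \<Longrightarrow> a t > 0"
    and "\<And>t. t \<in> I \<Longrightarrow> b t > 0" and "\<And>t. t \<in> I \<Longrightarrow> c t > 0"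
    and "f 0 = 1" and "a 0 = 1" and "b 0 = 1" and "c 0 = 1"
  shows "ricci_harmonic_flow I
      (\<lambda>t x is. f t * ((a t)^2 * e [1,2,7] is + (b t)^2 * e [3,4,7] is + (c t)^2 * e [5,6,7] is)
         + a t * b t * c t * (e [1,3,5] is - e [1,4,6] is - e [2,3,6] is - e [2,4,5] is))
      (\<lambda>x is. e [1,2,7] is + e [3,4,7] is + e [5,6,7] is
         + e [1,3,5] is - e [1,4,6] is - e [2,3,6] is - e [2,4,5] is)
    \<longleftrightarrow>
    (\<forall>t\<in>I.
      ((\<lambda>s. f s * (a s)^2) has_real_derivative
         - ((f t)^3 * (4 * (a t)^4 * ((b t)^4 + (c t)^4) - (b t)^4 * (c t)^4)
            / (2 * (a t)^2 * (b t)^4 * (c t)^4))) (at t within I) \<and>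
      ((\<lambda>s. f s * (b s)^2) has_real_derivative
         - ((f t)^3 * (4 * (b t)^4 * ((a t)^4 + (c t)^4) - (a t)^4 * (c t)^4)
            / (2 * (a t)^4 * (b t)^2 * (c t)^4))) (at t within I) \<and>
      ((\<lambda>s. f s * (c s)^2) has_real_derivative
         - ((f t)^3 * (4 * (c t)^4 * ((a t)^4 + (b t)^4) - (a t)^4 * (b t)^4)
            / (2 * (a t)^4 * (b t)^4 * (c t)^2))) (at t within I) \<and>
      ((\<lambda>s. a s * b s * c s) has_real_derivative
         - ((f t)^2 * (3 * (a t * b t * c t)^2 * ((a t)^2 + (b t)^2 + (c t)^2)
              + 2 * ((a t)^4 * (b t)^4 + (a t)^4 * (c t)^4 + (b t)^4 * (c t)^4))
            / (2 * (a t)^3 * (b t)^3 * (c t)^3))) (at t within I))"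
    (is "ricci_harmonic_flow I ?\<Phi> ?\<Psi> \<longleftrightarrow> (\<forall>t\<in>I. ?D1 t \<and> ?D2 t \<and> ?D3 t \<and> ?D4 t)")
proof -
  have loc: "diagonal_G2 (f t) (a t) (b t) (c t)" if "t \<in> I" for t
    using assms(7-10) that by unfold_locales
  have \<Phi>: "?\<Phi> t = (\<lambda>_. diagonal_G2.phi (f t) (a t) (b t) (c t))" if "t \<in> I" for t
    unfolding diagonal_G2.phi_def[OF loc[OF that]] ..
  have struct: "G2_structure (?\<Phi> t)" if "t \<in> I" for t
    unfolding \<Phi>[OF that] by (rule diagonal_G2.G2_structure_phi[OF loc[OF that]])
  have initial: "?\<Phi> 0 x [i,j,k] = ?\<Psi> x [i,j,k]" for x :: heis and i j k
    using assms(11-14) by simp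
  have component: "?\<Phi> s x [i,j,k] =
      (f s * (a s)^2) * e [1,2,7] [i,j,k] + (f s * (b s)^2) * e [3,4,7] [i,j,k]
      + (f s * (c s)^2) * e [5,6,7] [i,j,k]
      + (a s * b s * c s) * (e [1,3,5] [i,j,k] - e [1,4,6] [i,j,k] - e [2,3,6] [i,j,k] - e [2,4,5] [i,j,k])"
    for s and x :: heis and i j k
    by (simp add: distrib_left mult.assoc)
  have "(\<forall>x i j k. ((\<lambda>s. ?\<Phi> s x [i,j,k]) has_real_derivative ricci_harmonic_rhs (?\<Phi> t) x [i,j,k]) (at t within I))
      \<longleftrightarrow> ?D1 t \<and> ?D2 t \<and> ?D3 t \<and> ?D4 t" if t: "t \<in> I" for t
  proof -
    note rhs = diagonal_G2.ricci_harmonic_rhs_phi[OF loc[OF t]]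
    show ?thesis
      unfolding \<Phi>[OF t] rhs component
      by (simp only: has_derivative_components simp_thms)
  qed
  then show ?thesis
    unfolding ricci_harmonic_flow_def using struct initial by simp
qed

end
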